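(* Let $\alpha\in(0,1)$ and assume that (i) the function $x\mapsto \mathbb{E}[h_\alpha(x-D)]$ is quasiconvex on $\mathbb{X}$, and (ii) $\lim_{x\to-\infty}\mathbb{E}[h_\alpha(x-D)]>K+\inf_{x\in\mathbb{X}}\mathbb{E}[h_\alpha(x-D)]$. Then for the infinite-horizon problem with discount factor $\alpha$ there exists an optimal $(s_\alpha,S_\alpha)$ policy, where $S_\alpha$ and $s_\alpha$ are real numbers such that $$S_\alpha\in\operatorname*{arg\,min}_{x\in\mathbb{X}}G_\alpha(x),\qquad s_\alpha=\inf\{x\le S_\alpha:\ G_\alpha(x)\le K+G_\alpha(S_\alpha)\}.$$
   Context: Inventory model. Either (a) $\mathbb{X}=\mathbb{R}$ (states) and $\mathbb{A}=[0,+\infty)$ (actions), or (b) $\mathbb{X}=\mathbb{Z}$, $\mathbb{A}=\{0,1,2,\ldots\}$ and the demand is integer valued. Constants $K>0$ (fixed ordering cost), $\bar c>0$ (unit ordering cost). $D_1,D_2,\ldots$ are i.i.d. nonnegative finite random variables, $D$ has the same distribution as $D_1$, $\mathbb{E}[D]<+\infty$, $P(D>0)>0$. The holding/backlog cost function $h$ is such that $x\mapsto\mathbb{E}[h(x-D)]$ is finite, continuous and nonnegative on $\mathbb{X}$ and $\mathbb{E}[h(x-D)]\to+\infty$ as $|x|\to+\infty$. Dynamics: $x_{t+1}=x_t+a_t-D_{t+1}$, $t=0,1,\ldots$. One-step cost: $c(x,a)=K\mathbf{1}_{\{a>0\}}+\bar c a+\mathbb{E}[h(x+a-D)]$. Policies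 may be randomized and history-dependent; $\mathbb{E}_x^\pi$ is the expectation for initial state $x$ and policy $\pi$. $v_\alpha^\pi(x)=\mathbb{E}_x^\pi[\sum_{t=0}^\infty\alpha^t c(x_t,a_t)]$, $v_\alpha(x)=\inf_\pi v^\pi_\alpha(x)$; $\pi$ is optimal (for discount factor $\alpha$) if $v^\pi_\alpha(x)=v_\alpha(x)$ for all $x\in\mathbb{X}$. For $\alpha\in(0,1]$: $h_\alpha(x):=h(x)+(1-\alpha)\bar c x+\bar c\,\mathbb{E}[D]$. $G_\alpha(x):=\bar c x+\mathbb{E}[h(x-D)]+\alpha\mathbb{E}[v_\alpha(x-D)]$. A function $f$ is quasiconvex if $f(\lambda x+(1-\lambda)y)\le\max\{f(x),f(y)\}$ for all $x,y$ and $\lambda\in[0,1]$ (if $\mathbb{X}=\mathbb{Z}$, whenever $x,y,\lambda x+(1-\lambda)y\in\mathbb{Z}$). For reals $s\le S$, an $(s,S)$ policy is the stationary policy that orders up to level $S$ (action $S-x$) if the current state $x<s$ and does not order (action $0$) if $x\ge s$. *)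

theory Defs
  imports "HOL-Probability.Probability"
begin

text \<open>
  For \<^prop>\<open>X = \<int>\<close> the bound is only required at the integer points between \<open>x\<close> and \<open>y\<close>.
\<close>

definition quasiconvex_on :: "real set \<Rightarrow> (real \<Rightarrow> real) \<Rightarrow> bool" where
  "quasiconvex_on X f \<longleftrightarrow>
    (\<forall>x\<in>X. \<forall>y\<in>X. \<forall>l\<in>{0..1}. l * x + (1 - l) * y \<in> X \<longrightarrow>
       f (l * x + (1 - l) * y) \<le> max (f x) (f y))"

text \<open>
  The integer-valued model is embedded into the reals, as \<^prop>\<open>X = \<int>\<close>. The demands are
  \<open>D 1, D 2, \<dots>\<close> (the value \<open>D 0\<close> is not used), and \<open>D 1\<close> plays the role of the generic
  demand. The functions \<open>h\<close> and \<open>x \<mapsto> E h(x - D)\<close> are only constrained on \<open>X\<close>; that \<open>E h(x - D)\<close>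
  is finite is expressed by integrability, which includes measurability of \<open>h(x - D)\<close>.
\<close>

locale inventory_model = prob_space M
  for M :: "'w measure" +
  fixes X :: "real set"
    and D :: "nat \<Rightarrow> 'w \<Rightarrow> real"
    and h :: "real \<Rightarrow> real"
    and K cbar :: real
  assumes X_cases:
      "X = UNIV \<or> (X = \<int> \<and> (\<forall>t\<ge>1. \<forall>\<omega>\<in>space M. D t \<omega> \<in> \<int>))"
    and K_pos: "K > 0"
    and cbar_pos: "cbar > 0"
    and D_indep: "indep_vars (\<lambda>_. borel) D {1..}"
    and D_ident: "\<And>t. t \<ge> 1 \<Longrightarrow> distr M borel (D t) = distr M borel (D 1)"
    and D_nonneg: "\<And>t \<omega>. t \<ge> 1 \<Longrightarrow> \<omega> \<in> space M \<Longrightarrow> D t \<omega> \<ge> 0"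
    and D_integrable: "integrable M (D 1)"
    and D_pos: "prob {\<omega> \<in> space M. D 1 \<omega> > 0} > 0"
    and h_integrable: "\<And>x. x \<in> X \<Longrightarrow> integrable M (\<lambda>\<omega>. h (x - D 1 \<omega>))"
    and h_nonneg: "\<And>x. x \<in> X \<Longrightarrow> expectation (\<lambda>\<omega>. h (x - D 1 \<omega>)) \<ge> 0"
    and h_cont: "continuous_on X (\<lambda>x. expectation (\<lambda>\<omega>. h (x - D 1 \<omega>)))"
    and h_lim: "filterlim (\<lambda>x. expectation (\<lambda>\<omega>. h (x - D 1 \<omega>))) at_top
                  (inf at_infinity (principal X))"
begin

definition cost :: "real \<Rightarrow> real \<Rightarrow> real" where
  "cost x a = (if a > 0 then K else 0) + cbar * a + expectation (\<lambda>\<omega>. h (x + a - D 1 \<omega>))"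

definition state_space :: "real measure" where
  "state_space = restrict_space borel X"

definition action_space :: "real measure" where
  "action_space = restrict_space borel {a \<in> X. a \<ge> 0}"

text \<open>
  A path is a sequence of pairs \<open>(x\<^sub>t, a\<^sub>t)\<close>. The history at time \<open>t\<close> consists of the first \<open>t\<close> pairs
  together with the current state, \<open>(x\<^sub>0, a\<^sub>0, \<dots>, x\<^bsub>t-1\<^esub>, a\<^bsub>t-1\<^esub>, x\<^sub>t)\<close>. A policy is a sequence of
  transition probabilities from histories to actions.
\<close>

definition pair_space :: "(real \<times> real) measure" where
  "pair_space = state_space \<Otimes>\<^sub>M action_space"

definition history_space :: "nat \<Rightarrow> ((nat \<Rightarrow> real \<times> real) \<times> real) measure" where
  "history_space t = (\<Pi>\<^sub>M i\<in>{0..<t}. pair_space) \<Otimes>\<^sub>M state_space"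

definition policies :: "(nat \<Rightarrow> (nat \<Rightarrow> real \<times> real) \<times> real \<Rightarrow> real measure) set" where
  "policies = {\<pi>. \<forall>t. \<pi> t \<in> history_space t \<rightarrow>\<^sub>M prob_algebra action_space}"

text \<open>
  The conditional law of the state at time \<open>t\<close>, given the preceding pairs, for initial state \<open>x\<close>.
\<close>

fun next_state :: "real \<Rightarrow> nat \<Rightarrow> (nat \<Rightarrow> real \<times> real) \<Rightarrow> real measure" where
  "next_state x 0 p = return state_space x"
| "next_state x (Suc t) p =
     distr M state_space (\<lambda>\<omega>. fst (p t) + snd (p t) - D (Suc t) \<omega>)"

definition next_pair ::
  "(nat \<Rightarrow> (nat \<Rightarrow> real \<times> real) \<times> real \<Rightarrow> real measure) \<Rightarrow> real \<Rightarrow>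
     nat \<Rightarrow> (nat \<Rightarrow> real \<times> real) \<Rightarrow> (real \<times> real) measure" where
  "next_pair \<pi> x t p =
     next_state x t p \<bind> (\<lambda>y. \<pi> t (p, y) \<bind> (\<lambda>a. return pair_space (y, a)))"

text \<open>
  The measure on infinite paths obtained from the kernels \<open>next_pair \<pi> x\<close> by the theorem of
  Ionescu Tulcea; the lemma \<open>Ionescu_Tulcea_next_pair\<close> below discharges its hypotheses.
\<close>

definition path_measure ::
  "(nat \<Rightarrow> (nat \<Rightarrow> real \<times> real) \<times> real \<Rightarrow> real measure) \<Rightarrow> real \<Rightarrow>
     (nat \<Rightarrow> real \<times> real) measure" where
  "path_measure \<pi> x =
     projective_family.lim UNIV
       (Ionescu_Tulcea.CI (next_pair \<pi> x) (\<lambda>_. pair_space)) (\<lambda>_. pair_space)"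

text \<open>
  Since \<open>cost\<close> is nonnegative on \<open>X \<times> {a \<in> X. a \<ge> 0}\<close>, values are taken in \<^typ>\<open>ennreal\<close>.
\<close>

definition policy_value ::
  "real \<Rightarrow> (nat \<Rightarrow> (nat \<Rightarrow> real \<times> real) \<times> real \<Rightarrow> real measure) \<Rightarrow> real \<Rightarrow> ennreal" where
  "policy_value \<alpha> \<pi> x =
     (\<integral>\<^sup>+ p. (\<Sum>t. ennreal (\<alpha> ^ t * cost (fst (p t)) (snd (p t)))) \<partial>path_measure \<pi> x)"

definition value_fun :: "real \<Rightarrow> real \<Rightarrow> ennreal" where
  "value_fun \<alpha> x = (INF \<pi>\<in>policies. policy_value \<alpha> \<pi> x)"

definition optimal ::
  "real \<Rightarrow> (nat \<Rightarrow> (nat \<Rightarrow> real \<times> real) \<times> real \<Rightarrow> real measure) \<Rightarrow> bool" where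
  "optimal \<alpha> \<pi> \<longleftrightarrow> \<pi> \<in> policies \<and> (\<forall>x\<in>X. policy_value \<alpha> \<pi> x = value_fun \<alpha> x)"

definition stationary_policy ::
  "(real \<Rightarrow> real) \<Rightarrow> nat \<Rightarrow> (nat \<Rightarrow> real \<times> real) \<times> real \<Rightarrow> real measure" where
  "stationary_policy \<phi> t = (\<lambda>(p, x). return action_space (\<phi> x))"

definition sS_policy ::
  "real \<Rightarrow> real \<Rightarrow> nat \<Rightarrow> (nat \<Rightarrow> real \<times> real) \<times> real \<Rightarrow> real measure" where
  "sS_policy s S = stationary_policy (\<lambda>x. if x < s then S - x else 0)"

definition h_disc :: "real \<Rightarrow> real \<Rightarrow> real" where
  "h_disc \<alpha> x = h x + (1 - \<alpha>) * cbar * x + cbar * expectation (D 1)"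

definition Eh_disc :: "real \<Rightarrow> real \<Rightarrow> real" where
  "Eh_disc \<alpha> x = expectation (\<lambda>\<omega>. h_disc \<alpha> (x - D 1 \<omega>))"

text \<open>
  Extended-real valued, so that finiteness of \<open>E v\<^sub>\<alpha>(x - D)\<close> is not presupposed.
\<close>

definition G :: "real \<Rightarrow> real \<Rightarrow> ereal" where
  "G \<alpha> x = ereal (cbar * x + expectation (\<lambda>\<omega>. h (x - D 1 \<omega>)))
             + ereal \<alpha> * enn2ereal (\<integral>\<^sup>+ \<omega>. value_fun \<alpha> (x - D 1 \<omega>) \<partial>M)"

lemma D_measurable: "t \<ge> 1 \<Longrightarrow> D t \<in> borel_measurable M"
  using D_indep by (auto simp: indep_vars_def)

lemma space_state_space [simp]: "space state_space = X"
  by (simp add: state_space_def space_restrict_space)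

lemma space_action_space [simp]: "space action_space = {a \<in> X. a \<ge> 0}"
  by (simp add: action_space_def space_restrict_space)

lemma next_level_in_X:
  "x \<in> X \<Longrightarrow> a \<in> X \<Longrightarrow> t \<ge> 1 \<Longrightarrow> \<omega> \<in> space M \<Longrightarrow> x + a - D t \<omega> \<in> X"
  using X_cases by auto

lemma measurable_next_state:
  assumes x: "x \<in> X"
  shows "next_state x t \<in> (\<Pi>\<^sub>M i\<in>{0..<t}. pair_space) \<rightarrow>\<^sub>M prob_algebra state_space"
proof (cases t)
  case 0
  have "return state_space x \<in> space (prob_algebra state_space)"
    using x by (auto simp: space_prob_algebra intro!: prob_space_return)
  moreover have "next_state x t = (\<lambda>p. return state_space x)"
    using 0 by (simp add: fun_eq_iff)
  ultimately show ?thesis by simp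
next
  case (Suc n)
  let ?H = "\<Pi>\<^sub>M i\<in>{0..<Suc n}. pair_space"
  have comp: "(\<lambda>p. p n) \<in> ?H \<rightarrow>\<^sub>M state_space \<Otimes>\<^sub>M action_space"
    unfolding pair_space_def[symmetric] by (rule measurable_component_singleton) simp
  have f: "(\<lambda>p. fst (p n)) \<in> ?H \<rightarrow>\<^sub>M state_space" "(\<lambda>p. snd (p n)) \<in> ?H \<rightarrow>\<^sub>M action_space"
    using measurable_compose[OF comp measurable_fst] measurable_compose[OF comp measurable_snd]
    by auto
  have fX: "fst (p n) \<in> X" "snd (p n) \<in> X" if "p \<in> space ?H" for p
    using measurable_space[OF f(1) that] measurable_space[OF f(2) that] by auto
  have [measurable]: "(\<lambda>p. fst (p n)) \<in> borel_measurable ?H" "(\<lambda>p. snd (p n)) \<in> borel_measurable ?H"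
    using f unfolding state_space_def action_space_def
    by (auto simp: measurable_restrict_space2_iff)
  have [measurable]: "D (Suc n) \<in> borel_measurable M"
    by (rule D_measurable) simp
  have "(\<lambda>(p, \<omega>). fst (p n) + snd (p n) - D (Suc n) \<omega>) \<in> ?H \<Otimes>\<^sub>M M \<rightarrow>\<^sub>M state_space"
    unfolding state_space_def
    by (rule measurable_restrict_space2)
       (auto simp: space_pair_measure intro!: next_level_in_X fX)
  moreover have "(\<lambda>p. M) \<in> ?H \<rightarrow>\<^sub>M prob_algebra M"
    by (rule measurable_const) (simp add: space_prob_algebra prob_space_axioms)
  ultimately have "(\<lambda>p. distr M state_space (\<lambda>\<omega>. fst (p n) + snd (p n) - D (Suc n) \<omega>))
      \<in> ?H \<rightarrow>\<^sub>M prob_algebra state_space"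
    by (intro measurable_distr_prob_space2[where M = M]) auto
  moreover have "next_state x t =
      (\<lambda>p. distr M state_space (\<lambda>\<omega>. fst (p n) + snd (p n) - D (Suc n) \<omega>))"
    using Suc by (simp add: fun_eq_iff)
  ultimately show ?thesis using Suc by simp
qed

lemma measurable_next_pair:
  assumes "\<pi> \<in> policies" "x \<in> X"
  shows "next_pair \<pi> x t \<in> (\<Pi>\<^sub>M i\<in>{0..<t}. pair_space) \<rightarrow>\<^sub>M prob_algebra pair_space"
proof -
  let ?H = "\<Pi>\<^sub>M i\<in>{0..<t}. pair_space"
  have pi: "\<pi> t \<in> ?H \<Otimes>\<^sub>M state_space \<rightarrow>\<^sub>M prob_algebra action_space"
    using assms(1) by (auto simp: policies_def history_space_def)
  have "(\<lambda>z. return pair_space (snd (fst z), snd z))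
      \<in> (?H \<Otimes>\<^sub>M state_space) \<Otimes>\<^sub>M action_space \<rightarrow>\<^sub>M prob_algebra pair_space"
    by (rule measurable_compose[OF _ measurable_return_prob_space])
       (simp add: pair_space_def)
  then have "(\<lambda>z. \<pi> t z \<bind> (\<lambda>a. return pair_space (snd z, a)))
      \<in> ?H \<Otimes>\<^sub>M state_space \<rightarrow>\<^sub>M prob_algebra pair_space"
    by (intro measurable_bind_prob_space2[OF pi]) (simp add: split_beta')
  then have "(\<lambda>p. next_state x t p \<bind> (\<lambda>y. \<pi> t (p, y) \<bind> (\<lambda>a. return pair_space (y, a))))
      \<in> ?H \<rightarrow>\<^sub>M prob_algebra pair_space"
    by (intro measurable_bind_prob_space2[OF measurable_next_state[OF assms(2)]])
       (simp add: split_beta')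
  then show ?thesis
    by (simp add: next_pair_def[abs_def])
qed

lemma Ionescu_Tulcea_next_pair:
  assumes "\<pi> \<in> policies" "x \<in> X"
  shows "Ionescu_Tulcea (next_pair \<pi> x) (\<lambda>_. pair_space)"
proof (rule Ionescu_Tulcea.intro)
  show "next_pair \<pi> x i \<in> (\<Pi>\<^sub>M i\<in>{0..<i}. pair_space) \<rightarrow>\<^sub>M subprob_algebra pair_space" for i
    using measurable_next_pair[OF assms] by (rule measurable_prob_algebraD)
  show "prob_space (next_pair \<pi> x i p)" if "p \<in> space (\<Pi>\<^sub>M i\<in>{0..<i}. pair_space)" for i p
    using measurable_space[OF measurable_next_pair[OF assms] that] by (simp add: space_prob_algebra)
qed

lemma cost_nonneg: "x \<in> X \<Longrightarrow> a \<in> X \<Longrightarrow> a \<ge> 0 \<Longrightarrow> cost x a \<ge> 0"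
  using X_cases K_pos cbar_pos h_nonneg[of "x + a"] by (auto simp: cost_def)

lemma sS_policy_in_policies:
  assumes "s \<le> S" "S \<in> X"
  shows "sS_policy s S \<in> policies"
proof -
  have "(\<lambda>x. if x < s then S - x else 0) \<in> state_space \<rightarrow>\<^sub>M action_space"
    unfolding state_space_def action_space_def
    using assms X_cases
    by (intro measurable_restrict_space2 measurable_restrict_space1)
       (auto simp: space_restrict_space)
  then have "(\<lambda>z. return action_space ((\<lambda>x. if x < s then S - x else 0) (snd z)))
      \<in> history_space t \<rightarrow>\<^sub>M prob_algebra action_space" for t
    unfolding history_space_def
    by (intro measurable_compose[OF _ measurable_return_prob_space]
              measurable_compose[OF measurable_snd])
  then show ?thesis
    by (simp add: policies_def sS_policy_def stationary_policy_def[abs_def] split_beta')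
qed

end

end

theory Submission
  imports Defs
begin

text \<open>
  Write \<open>g\<close> for \<open>E h\<^sub>\<alpha>(\<cdot> - D)\<close> and \<open>y0\<close> for its minimizer. Adding \<open>cbar x\<close> to the value function removes
  the unit ordering cost and turns the holding cost into \<open>g\<close>. As in Zheng's proof for the average
  cost criterion, a solution of the optimality equation is constructed directly. For a level \<open>c\<close> let
  \<open>u\<close> be the value of the stopping problem \<open>u = min 0 J\<close> with \<open>J(x) = g(x) - c + \<alpha> E u(x - D)\<close>. The
  minimum of \<open>J\<close> depends continuously on \<open>c\<close>, is \<open>0\<close> for \<open>c = g(y0)\<close> and at most \<open>-K\<close> for
  \<open>c = g(y0) + K\<close>, so it equals \<open>-K\<close> for some \<open>c\<close> in between; since \<open>c\<close> lies below the limit of \<open>g\<close> at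
  \<open>-\<infinity>\<close>, there is a least \<open>s\<close> with \<open>g(s) \<le> c\<close>. Let \<open>S\<close> minimize \<open>J\<close>. The \<open>(s, S)\<close> policy then has cost
  \<open>c / (1 - \<alpha>) + H(x) - cbar x\<close>, where \<open>H\<close> vanishes below \<open>s\<close> and solves
  \<open>H(x) = g(x) - c + \<alpha> E H(x - D)\<close> from \<open>s\<close> on, and this function satisfies the optimality equation.
\<close>

section \<open>Path measures\<close>

context Ionescu_Tulcea
begin

text \<open>By \<open>distr_lim\<close> the marginal of the limit on \<open>{0..<n}\<close> is
  \<open>CI {0..<n}\<close>, which is \<open>C 0 n\<close> pushed forward along a restriction;
  \<open>C 0 n\<close> already lives on functions over \<open>{0..<n}\<close>, so that restriction
  is invisible.\<close>

lemma nn_integral_lim_restrict: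
  assumes f[measurable]: "f \<in> borel_measurable (PiM {0..<n} M)"
  shows "(\<integral>\<^sup>+p. f (restrict p {0..<n}) \<partial>PF.lim) = (\<integral>\<^sup>+p. f p \<partial>C 0 n (\<lambda>_. undefined))"
proof -
  \<comment> \<open>\<open>CI J\<close> is a marginal of \<open>C 0 (up_to J)\<close>, where
    \<open>up_to J\<close> is the least bound beyond which \<open>J\<close> has no index; for an
    initial segment it is the length.\<close>
  have "up_to {0..<n} = n"
    using up_to[of "{0..<n}"] up_to_iff_Ico[of "{0..<n}" n] by fastforce
  then have CI: "CI {0..<n} = distr (C 0 n (\<lambda>_. undefined)) (PiM {0..<n} M) (\<lambda>p. restrict p {0..<n})"
    by (simp add: CI_def)
  have C: "sets (C 0 n (\<lambda>_. undefined)) = sets (PiM {0..<n} M)"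
    by (subst sets_C) (auto simp: space_PiM)
  have "(\<integral>\<^sup>+p. f (restrict p {0..<n}) \<partial>PF.lim) =
      (\<integral>\<^sup>+p. f p \<partial>distr PF.lim (PiM {0..<n} M) (\<lambda>p. restrict p {0..<n}))"
    by (subst nn_integral_distr)
       (auto intro!: measurable_restrict measurable_component_singleton
             simp: measurable_cong_sets[OF PF.sets_lim refl])
  also have "\<dots> = (\<integral>\<^sup>+p. f p \<partial>CI {0..<n})"
    by (simp add: distr_lim)
  also have "\<dots> = (\<integral>\<^sup>+p. f (restrict p {0..<n}) \<partial>C 0 n (\<lambda>_. undefined))"
    unfolding CI
    by (subst nn_integral_distr)
       (auto intro!: measurable_restrict measurable_component_singleton
             simp: measurable_cong_sets[OF C refl])
  also have "\<dots> = (\<integral>\<^sup>+p. f p \<partial>C 0 n (\<lambda>_. undefined))"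
    using nn_integral_C[of n n f 0 "\<lambda>_. undefined"] by (simp add: space_PiM)
  finally show ?thesis .
qed

text \<open>Disintegration at time \<open>n\<close>: \<open>C 0 (Suc n)\<close> is
  \<open>C 0 n\<close> bound to the kernel \<open>eP n\<close>, so coordinate \<open>n\<close> can
  be integrated first, given the earlier ones. All one-step computations on paths start from this
  form.\<close>

lemma nn_integral_lim_component:
  assumes f[measurable]: "f \<in> borel_measurable (M n)"
  shows "(\<integral>\<^sup>+p. f (p n) \<partial>PF.lim) =
    (\<integral>\<^sup>+p. (\<integral>\<^sup>+y. f y \<partial>P n (restrict p {0..<n})) \<partial>PF.lim)"
proof -
  let ?u = "\<lambda>_. undefined"
  have u: "?u \<in> space (PiM {0..<0} M)" by (simp add: space_PiM)
  have fn[measurable]: "(\<lambda>p. f (p n)) \<in> borel_measurable (PiM {0..<Suc n} M)"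
    by (rule measurable_compose[where N = "M n"]) (auto intro: measurable_component_singleton)
  have "(\<integral>\<^sup>+p. f (p n) \<partial>PF.lim) = (\<integral>\<^sup>+p. f ((restrict p {0..<Suc n}) n) \<partial>PF.lim)"
    by simp
  also have "\<dots> = (\<integral>\<^sup>+p. f (p n) \<partial>C 0 (Suc n) ?u)"
    by (rule nn_integral_lim_restrict[OF fn])
  also have "\<dots> = (\<integral>\<^sup>+p. (\<integral>\<^sup>+q. f (q n) \<partial>eP n p) \<partial>C 0 n ?u)"
    using measurable_eP[of n] sets_C[OF u, of n]
    by (simp, subst nn_integral_bind[where B="PiM {0..<Suc n} M"])
       (auto simp: measurable_cong_sets[OF sets_C[OF u] refl])
  also have "\<dots> = (\<integral>\<^sup>+p. (\<integral>\<^sup>+y. f y \<partial>P n p) \<partial>C 0 n ?u)"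
    using space_C[OF u, of n]
    by (intro nn_integral_cong) (simp add: nn_integral_eP)
  also have "\<dots> = (\<integral>\<^sup>+p. (\<integral>\<^sup>+y. f y \<partial>P n (restrict p {0..<n})) \<partial>PF.lim)"
    by (rule nn_integral_lim_restrict[symmetric])
       (rule measurable_compose[OF P nn_integral_measurable_subprob_algebra[OF f]])
  finally show ?thesis .
qed

end

context inventory_model
begin

lemma space_pair_space: "space pair_space = X \<times> {a \<in> X. 0 \<le> a}"
  by (simp add: pair_space_def space_pair_measure)

lemma measurable_pair_space [measurable]:
  "fst \<in> pair_space \<rightarrow>\<^sub>M state_space" "snd \<in> pair_space \<rightarrow>\<^sub>M action_space"
  by (simp_all add: pair_space_def)

lemma state_space_borel: "f \<in> borel_measurable borel \<Longrightarrow> f \<in> borel_measurable state_space"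
  by (simp add: state_space_def measurable_restrict_space1)

lemma measurable_order_up_to [measurable]: "(\<lambda>z. fst z + snd z) \<in> pair_space \<rightarrow>\<^sub>M state_space"
proof -
  have [measurable]: "fst \<in> borel_measurable pair_space" "snd \<in> borel_measurable pair_space"
    using measurable_pair_space unfolding state_space_def action_space_def
    by (auto simp: measurable_restrict_space2_iff)
  show ?thesis
    unfolding state_space_def using X_cases
    by (intro measurable_restrict_space2) (auto simp: space_pair_space)
qed

lemma measurable_demand [measurable]:
  assumes "t \<ge> 1"
  shows "(\<lambda>(y, \<omega>). y - D t \<omega>) \<in> state_space \<Otimes>\<^sub>M M \<rightarrow>\<^sub>M state_space"
proof -
  have [measurable]: "D t \<in> borel_measurable M" using D_measurable assms by auto
  have [measurable]: "(\<lambda>y. y) \<in> borel_measurable state_space" by (simp add: state_space_borel)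
  show ?thesis
    unfolding state_space_def using X_cases assms
    by (intro measurable_restrict_space2)
       (auto simp: space_pair_measure state_space_def[symmetric])
qed

lemma measurable_demand' [measurable]:
  "y \<in> X \<Longrightarrow> t \<ge> 1 \<Longrightarrow> (\<lambda>\<omega>. y - D t \<omega>) \<in> M \<rightarrow>\<^sub>M state_space"
  using measurable_compose[OF measurable_Pair1' measurable_demand, of y] by simp

lemma minus_demand_in_X: "y \<in> X \<Longrightarrow> t \<ge> 1 \<Longrightarrow> \<omega> \<in> space M \<Longrightarrow> y - D t \<omega> \<in> X"
  using X_cases by auto

text \<open>Equality of the demand laws applies to Borel functions of the demand, while
  \<open>F\<close> is only measurable on \<open>X\<close>. Multiplying by the indicator of
  \<open>X\<close> makes it Borel and changes nothing, since the state stays in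
  \<open>X\<close>.\<close>

lemma nn_integral_demand_ident:
  assumes F: "F \<in> borel_measurable state_space" and y: "y \<in> X" and t: "t \<ge> 1"
  shows "(\<integral>\<^sup>+\<omega>. F (y - D t \<omega>) \<partial>M) = (\<integral>\<^sup>+\<omega>. F (y - D 1 \<omega>) \<partial>M)"
proof -
  let ?G = "\<lambda>d. F (y - d) * indicator X (y - d)"
  have "(\<lambda>z. F z * indicator X z) \<in> borel_measurable borel"
    using F X_cases unfolding state_space_def
    by (subst borel_measurable_restrict_space_iff_ennreal[symmetric]) auto
  then have G: "?G \<in> borel_measurable borel" by measurable
  have *: "(\<integral>\<^sup>+\<omega>. F (y - D s \<omega>) \<partial>M) = (\<integral>\<^sup>+d. ?G d \<partial>distr M borel (D s))" if "s \<ge> 1" for s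
    using D_measurable[OF that] G y that
    by (subst nn_integral_distr)
       (auto intro!: nn_integral_cong simp: minus_demand_in_X indicator_def)
  show ?thesis
    unfolding *[OF t] using *[of 1] D_ident[OF t] by simp
qed

text \<open>Extended valued, so that it makes sense for value functions before their finiteness is
  known.\<close>

definition after_demand :: "(real \<Rightarrow> ennreal) \<Rightarrow> real \<Rightarrow> ennreal" where
  "after_demand F y = (\<integral>\<^sup>+\<omega>. F (y - D 1 \<omega>) \<partial>M)"

lemma measurable_after_demand [measurable]:
  assumes [measurable]: "F \<in> borel_measurable state_space"
  shows "after_demand F \<in> borel_measurable state_space"
proof -
  have "(\<lambda>(y, \<omega>). F (y - D 1 \<omega>)) \<in> borel_measurable (state_space \<Otimes>\<^sub>M M)"
    using measurable_compose[OF measurable_demand assms, of 1] by (simp add: split_beta')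
  then show ?thesis
    unfolding after_demand_def[abs_def] by (rule borel_measurable_nn_integral)
qed

section \<open>One-step integrals under the path measure of a policy\<close>

context
  fixes \<pi> x
  assumes pi: "\<pi> \<in> policies" and x: "x \<in> X"
begin

interpretation IT: Ionescu_Tulcea "next_pair \<pi> x" "\<lambda>_. pair_space"
  by (rule Ionescu_Tulcea_next_pair[OF pi x])

lemma sets_path_measure [measurable_cong]:
  "sets (path_measure \<pi> x) = sets (PiM UNIV (\<lambda>_. pair_space))"
  by (simp add: path_measure_def)

lemma space_path_measure: "space (path_measure \<pi> x) = UNIV \<rightarrow>\<^sub>E X \<times> {a \<in> X. 0 \<le> a}"
  by (simp add: path_measure_def space_PiM space_pair_space)

lemma measurable_path_component [measurable]: "(\<lambda>p. p t) \<in> path_measure \<pi> x \<rightarrow>\<^sub>M pair_space"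
  by (simp add: measurable_cong_sets[OF sets_path_measure refl] measurable_component_singleton)

lemma nn_integral_next_pair:
  assumes p: "p \<in> space (PiM {0..<t} (\<lambda>_. pair_space))" and f[measurable]: "f \<in> borel_measurable pair_space"
  shows "(\<integral>\<^sup>+z. f z \<partial>next_pair \<pi> x t p) =
    (\<integral>\<^sup>+y. (\<integral>\<^sup>+a. f (y, a) \<partial>\<pi> t (p, y)) \<partial>next_state x t p)"
proof -
  let ?H = "PiM {0..<t} (\<lambda>_. pair_space)"
  have pit: "\<pi> t \<in> ?H \<Otimes>\<^sub>M state_space \<rightarrow>\<^sub>M prob_algebra action_space"
    using pi by (auto simp: policies_def history_space_def)
  have pip: "(\<lambda>y. \<pi> t (p, y)) \<in> state_space \<rightarrow>\<^sub>M prob_algebra action_space"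
    using measurable_compose[OF measurable_Pair1'[OF p] pit] .
  have ns: "next_state x t p \<in> space (prob_algebra state_space)"
    using measurable_space[OF measurable_next_state[OF x] p] .
  then have sets_ns: "sets (next_state x t p) = sets state_space"
    by (simp add: space_prob_algebra)
  have ret: "(\<lambda>z. return pair_space z) \<in> pair_space \<rightarrow>\<^sub>M prob_algebra pair_space"
    by simp
  have k: "(\<lambda>y. \<pi> t (p, y) \<bind> (\<lambda>a. return pair_space (y, a))) \<in> state_space \<rightarrow>\<^sub>M prob_algebra pair_space"
    by (intro measurable_bind_prob_space2[OF pip])
       (simp add: split_beta' pair_space_def[symmetric] ret)
  have "(\<integral>\<^sup>+z. f z \<partial>next_pair \<pi> x t p) =
     (\<integral>\<^sup>+y. (\<integral>\<^sup>+z. f z \<partial>(\<pi> t (p, y) \<bind> (\<lambda>a. return pair_space (y, a)))) \<partial>next_state x t p)"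
    unfolding next_pair_def
    by (rule nn_integral_bind[OF f])
       (simp add: measurable_cong_sets[OF sets_ns refl] measurable_prob_algebraD[OF k])
  also have "\<dots> = (\<integral>\<^sup>+y. (\<integral>\<^sup>+a. f (y, a) \<partial>\<pi> t (p, y)) \<partial>next_state x t p)"
  proof (rule nn_integral_cong)
    fix y assume "y \<in> space (next_state x t p)"
    then have y: "y \<in> space state_space" using sets_eq_imp_space_eq[OF sets_ns] by simp
    have sets_pi: "sets (\<pi> t (p, y)) = sets action_space"
      using measurable_space[OF pip y] by (simp add: space_prob_algebra)
    have m: "(\<lambda>a. (y, a)) \<in> \<pi> t (p, y) \<rightarrow>\<^sub>M pair_space"
      unfolding pair_space_def measurable_cong_sets[OF sets_pi refl]
      by (rule measurable_Pair1'[OF y])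
    have "(\<integral>\<^sup>+z. f z \<partial>(\<pi> t (p, y) \<bind> (\<lambda>a. return pair_space (y, a)))) =
        (\<integral>\<^sup>+a. (\<integral>\<^sup>+z. f z \<partial>return pair_space (y, a)) \<partial>\<pi> t (p, y))"
      by (rule nn_integral_bind[OF f]) (rule measurable_compose[OF m return_measurable])
    also have "\<dots> = (\<integral>\<^sup>+a. f (y, a) \<partial>\<pi> t (p, y))"
      using measurable_space[OF m] by (intro nn_integral_cong) (simp add: nn_integral_return)
    finally show "(\<integral>\<^sup>+z. f z \<partial>(\<pi> t (p, y) \<bind> (\<lambda>a. return pair_space (y, a)))) =
        (\<integral>\<^sup>+a. f (y, a) \<partial>\<pi> t (p, y))" .
  qed
  finally show ?thesis .
qed

lemma nn_integral_path_pair: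
  assumes f[measurable]: "f \<in> borel_measurable pair_space"
  shows "(\<integral>\<^sup>+p. f (p t) \<partial>path_measure \<pi> x) =
    (\<integral>\<^sup>+p. (\<integral>\<^sup>+y. (\<integral>\<^sup>+a. f (y, a) \<partial>\<pi> t (restrict p {0..<t}, y)) \<partial>next_state x t (restrict p {0..<t}))
      \<partial>path_measure \<pi> x)"
proof -
  have "(\<integral>\<^sup>+p. f (p t) \<partial>path_measure \<pi> x) =
    (\<integral>\<^sup>+p. (\<integral>\<^sup>+z. f z \<partial>next_pair \<pi> x t (restrict p {0..<t})) \<partial>path_measure \<pi> x)"
    unfolding path_measure_def by (rule IT.nn_integral_lim_component[OF f])
  also have "\<dots> = (\<integral>\<^sup>+p. (\<integral>\<^sup>+y. (\<integral>\<^sup>+a. f (y, a) \<partial>\<pi> t (restrict p {0..<t}, y)) \<partial>next_state x t (restrict p {0..<t}))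
      \<partial>path_measure \<pi> x)"
    by (intro nn_integral_cong nn_integral_next_pair f)
       (auto simp: space_path_measure space_PiM space_pair_space)
  finally show ?thesis .
qed

text \<open>The law of the action has total mass one, so it drops out when only the state is
  integrated.\<close>

lemma nn_integral_path_state:
  assumes F[measurable]: "F \<in> borel_measurable state_space"
  shows "(\<integral>\<^sup>+p. F (fst (p t)) \<partial>path_measure \<pi> x) =
    (\<integral>\<^sup>+p. (\<integral>\<^sup>+y. F y \<partial>next_state x t (restrict p {0..<t})) \<partial>path_measure \<pi> x)"
proof -
  have "(\<integral>\<^sup>+p. F (fst (p t)) \<partial>path_measure \<pi> x) =
    (\<integral>\<^sup>+p. (\<integral>\<^sup>+y. (\<integral>\<^sup>+a. F y \<partial>\<pi> t (restrict p {0..<t}, y)) \<partial>next_state x t (restrict p {0..<t}))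
      \<partial>path_measure \<pi> x)"
    by (subst nn_integral_path_pair[where f = "\<lambda>z. F (fst z)"]) simp_all
  also have "\<dots> = (\<integral>\<^sup>+p. (\<integral>\<^sup>+y. F y \<partial>next_state x t (restrict p {0..<t})) \<partial>path_measure \<pi> x)"
  proof (intro nn_integral_cong)
    fix p y assume p: "p \<in> space (path_measure \<pi> x)"
      and y: "y \<in> space (next_state x t (restrict p {0..<t}))"
    have r: "restrict p {0..<t} \<in> space (PiM {0..<t} (\<lambda>_. pair_space))"
      using p by (auto simp: space_path_measure space_PiM space_pair_space)
    have "next_state x t (restrict p {0..<t}) \<in> space (prob_algebra state_space)"
      using measurable_space[OF measurable_next_state[OF x] r] .
    then have "y \<in> X"
      using y by (auto simp: space_prob_algebra dest!: sets_eq_imp_space_eq)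
    then have "(restrict p {0..<t}, y) \<in> space (history_space t)"
      using r by (simp add: history_space_def space_pair_measure)
    moreover have "\<pi> t \<in> history_space t \<rightarrow>\<^sub>M prob_algebra action_space"
      using pi by (auto simp: policies_def)
    ultimately have "\<pi> t (restrict p {0..<t}, y) \<in> space (prob_algebra action_space)"
      by (rule measurable_space[rotated])
    then have "prob_space (\<pi> t (restrict p {0..<t}, y))"
      by (simp add: space_prob_algebra)
    then show "(\<integral>\<^sup>+a. F y \<partial>\<pi> t (restrict p {0..<t}, y)) = F y"
      by (simp add: prob_space.emeasure_space_1)
  qed
  finally show ?thesis .
qed

text \<open>The total mass is read off the empty initial segment, where \<open>C 0 0\<close> is a
  point mass.\<close>

lemma prob_space_path_measure: "prob_space (path_measure \<pi> x)"
proof -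
  have "(\<integral>\<^sup>+p. 1 \<partial>path_measure \<pi> x) = (\<integral>\<^sup>+p. 1 \<partial>IT.C 0 0 (\<lambda>_. undefined))"
    unfolding path_measure_def using IT.nn_integral_lim_restrict[of "\<lambda>_. 1" 0] by simp
  also have "\<dots> = 1"
    by (subst IT.C.simps, subst nn_integral_return) (auto simp: space_PiM)
  finally show ?thesis by (auto intro!: prob_spaceI)
qed

lemma nn_integral_path_0:
  assumes F[measurable]: "F \<in> borel_measurable state_space"
  shows "(\<integral>\<^sup>+p. F (fst (p 0)) \<partial>path_measure \<pi> x) = F x"
proof -
  interpret P: prob_space "path_measure \<pi> x" by (rule prob_space_path_measure)
  show ?thesis
    using x by (simp add: nn_integral_path_state nn_integral_return P.emeasure_space_1)
qed

text \<open>The kernel for time \<open>Suc t\<close> draws the demand afresh given the past, and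
  identical distribution lets \<open>D 1\<close> stand in for \<open>D (Suc t)\<close>.\<close>

lemma nn_integral_path_Suc:
  assumes F[measurable]: "F \<in> borel_measurable state_space"
  shows "(\<integral>\<^sup>+p. F (fst (p (Suc t))) \<partial>path_measure \<pi> x) =
    (\<integral>\<^sup>+p. after_demand F (fst (p t) + snd (p t)) \<partial>path_measure \<pi> x)"
  unfolding nn_integral_path_state[OF F]
proof (rule nn_integral_cong)
  fix p assume "p \<in> space (path_measure \<pi> x)"
  then have "p t \<in> X \<times> {a \<in> X. 0 \<le> a}" by (auto simp: space_path_measure)
  then have y: "fst (p t) + snd (p t) \<in> X" using X_cases by auto
  show "(\<integral>\<^sup>+y. F y \<partial>next_state x (Suc t) (restrict p {0..<Suc t})) = after_demand F (fst (p t) + snd (p t))"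
    using measurable_demand'[OF y, of "Suc t"] nn_integral_demand_ident[OF F y, of "Suc t"]
    by (simp add: nn_integral_distr after_demand_def)
qed

end

lemma nn_integral_path_stationary:
  assumes pol: "stationary_policy \<phi> \<in> policies" and x: "x \<in> X"
    and phi[measurable]: "\<phi> \<in> state_space \<rightarrow>\<^sub>M action_space" and f[measurable]: "f \<in> borel_measurable pair_space"
  shows "(\<integral>\<^sup>+p. f (p t) \<partial>path_measure (stationary_policy \<phi>) x) =
    (\<integral>\<^sup>+p. f (fst (p t), \<phi> (fst (p t))) \<partial>path_measure (stationary_policy \<phi>) x)"
proof -
  let ?P = "path_measure (stationary_policy \<phi>) x"
  have [measurable]: "(\<lambda>y. (y, \<phi> y)) \<in> state_space \<rightarrow>\<^sub>M pair_space"
    unfolding pair_space_def by measurable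
  have "(\<integral>\<^sup>+p. f (p t) \<partial>?P) =
    (\<integral>\<^sup>+p. (\<integral>\<^sup>+y. f (y, \<phi> y) \<partial>next_state x t (restrict p {0..<t})) \<partial>?P)"
    unfolding nn_integral_path_pair[OF pol x f]
  proof (intro nn_integral_cong)
    fix p y assume p: "p \<in> space ?P" and y: "y \<in> space (next_state x t (restrict p {0..<t}))"
    have r: "restrict p {0..<t} \<in> space (PiM {0..<t} (\<lambda>_. pair_space))"
      using p by (auto simp: space_path_measure[OF pol x] space_PiM space_pair_space)
    have "next_state x t (restrict p {0..<t}) \<in> space (prob_algebra state_space)"
      using measurable_space[OF measurable_next_state[OF x] r] .
    then have yX: "y \<in> space state_space"
      using y by (auto simp: space_prob_algebra dest!: sets_eq_imp_space_eq)
    have "(\<lambda>a. f (y, a)) \<in> borel_measurable action_space"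
      by (rule measurable_compose[OF measurable_Pair1'[OF yX] f[unfolded pair_space_def]])
    then show "(\<integral>\<^sup>+a. f (y, a) \<partial>stationary_policy \<phi> t (restrict p {0..<t}, y)) = f (y, \<phi> y)"
      using measurable_space[OF phi yX] by (simp add: stationary_policy_def nn_integral_return)
  qed
  also have "\<dots> = (\<integral>\<^sup>+p. f (fst (p t), \<phi> (fst (p t))) \<partial>?P)"
    by (rule nn_integral_path_state[OF pol x, symmetric, where F = "\<lambda>y. f (y, \<phi> y)"]) simp
  finally show ?thesis .
qed

end

section \<open>Comparing policy values with solutions of the optimality equation\<close>

context inventory_model
begin

abbreviation mean :: "(real \<Rightarrow> real) \<Rightarrow> real \<Rightarrow> real" where
  "mean f y \<equiv> expectation (\<lambda>\<omega>. f (y - D 1 \<omega>))"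

lemma measurable_cost [measurable]:
  "(\<lambda>z. ennreal (cost (fst z) (snd z))) \<in> borel_measurable pair_space"
proof -
  have hold: "mean h \<in> borel_measurable state_space"
    unfolding state_space_def by (rule borel_measurable_continuous_on_restrict[OF h_cont])
  have [measurable]: "(\<lambda>z. mean h (fst z + snd z)) \<in> borel_measurable pair_space"
    by (rule measurable_compose[OF measurable_order_up_to hold])
  have [measurable]: "fst \<in> borel_measurable pair_space" "snd \<in> borel_measurable pair_space"
    using measurable_pair_space unfolding state_space_def action_space_def
    by (auto simp: measurable_restrict_space2_iff)
  show ?thesis unfolding cost_def by measurable
qed

lemma policy_value_suminf:
  assumes "0 < \<alpha>" and pi: "\<pi> \<in> policies" and x: "x \<in> X"
  shows "policy_value \<alpha> \<pi> x =
    (\<Sum>t. ennreal (\<alpha> ^ t) * (\<integral>\<^sup>+p. ennreal (cost (fst (p t)) (snd (p t))) \<partial>path_measure \<pi> x))"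
proof -
  note [measurable] = measurable_compose[OF measurable_path_component[OF pi x] measurable_cost]
  have "policy_value \<alpha> \<pi> x =
      (\<integral>\<^sup>+p. (\<Sum>t. ennreal (\<alpha> ^ t) * ennreal (cost (fst (p t)) (snd (p t)))) \<partial>path_measure \<pi> x)"
    unfolding policy_value_def
  proof (intro nn_integral_cong suminf_cong)
    fix p t assume "p \<in> space (path_measure \<pi> x)"
    then have "p t \<in> X \<times> {a \<in> X. 0 \<le> a}" by (auto simp: space_path_measure[OF pi x])
    then have "cost (fst (p t)) (snd (p t)) \<ge> 0" by (auto intro!: cost_nonneg)
    then show "ennreal (\<alpha> ^ t * cost (fst (p t)) (snd (p t))) =
        ennreal (\<alpha> ^ t) * ennreal (cost (fst (p t)) (snd (p t)))"
      using \<open>0 < \<alpha>\<close> by (simp add: ennreal_mult)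
  qed
  also have "\<dots> = (\<Sum>t. ennreal (\<alpha> ^ t) * (\<integral>\<^sup>+p. ennreal (cost (fst (p t)) (snd (p t))) \<partial>path_measure \<pi> x))"
    by (subst nn_integral_suminf) (auto simp: nn_integral_cmult)
  finally show ?thesis .
qed

lemma nn_integral_demand: "(\<integral>\<^sup>+\<omega>. ennreal (D 1 \<omega>) \<partial>M) = ennreal (expectation (D 1))"
  using D_integrable D_nonneg by (intro nn_integral_eq_integral) auto

lemma measurable_state_ennreal:
  "F \<in> borel_measurable borel \<Longrightarrow> (\<lambda>y. ennreal (F y)) \<in> borel_measurable state_space"
  by (rule state_space_borel) simp

lemma nn_integral_path_negative_part:
  assumes pi: "\<pi> \<in> policies" and x: "x \<in> X"
  shows "(\<integral>\<^sup>+p. ennreal (max 0 (- fst (p n))) \<partial>path_measure \<pi> x) \<le>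
    ennreal (\<bar>x\<bar> + n * expectation (D 1))"
proof (induction n)
  have meas[measurable]: "(\<lambda>y. ennreal (max 0 (- y))) \<in> borel_measurable state_space"
    by (rule measurable_state_ennreal) simp
  interpret P: prob_space "path_measure \<pi> x" by (rule prob_space_path_measure[OF pi x])
  have ED: "expectation (D 1) \<ge> 0"
    using D_nonneg by (intro integral_nonneg_AE) auto
  {
    case 0
    show ?case
      by (subst nn_integral_path_0[OF pi x meas]) (auto intro!: ennreal_leI)
  next
    case (Suc n)
    have [measurable]: "D 1 \<in> borel_measurable M" using D_measurable by auto
    have [measurable]: "(\<lambda>p. ennreal (max 0 (- fst (p n)))) \<in> borel_measurable (path_measure \<pi> x)"
      by (intro measurable_compose[OF _ meas] measurable_compose[OF measurable_path_component[OF pi x]]) simp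
    have "(\<integral>\<^sup>+p. ennreal (max 0 (- fst (p (Suc n)))) \<partial>path_measure \<pi> x) =
      (\<integral>\<^sup>+p. after_demand (\<lambda>y. ennreal (max 0 (- y))) (fst (p n) + snd (p n)) \<partial>path_measure \<pi> x)"
      by (rule nn_integral_path_Suc[OF pi x meas])
    also have "\<dots> \<le> (\<integral>\<^sup>+p. ennreal (max 0 (- fst (p n))) + ennreal (expectation (D 1)) \<partial>path_measure \<pi> x)"
    proof (rule nn_integral_mono)
      fix p assume "p \<in> space (path_measure \<pi> x)"
      then have "p n \<in> X \<times> {a \<in> X. 0 \<le> a}" by (auto simp: space_path_measure[OF pi x])
      then have a: "snd (p n) \<ge> 0" by auto
      have "after_demand (\<lambda>y. ennreal (max 0 (- y))) (fst (p n) + snd (p n))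
          \<le> (\<integral>\<^sup>+\<omega>. ennreal (max 0 (- fst (p n))) + ennreal (D 1 \<omega>) \<partial>M)"
        unfolding after_demand_def
      proof (rule nn_integral_mono)
        fix \<omega> assume "\<omega> \<in> space M"
        then have D: "D 1 \<omega> \<ge> 0" using D_nonneg[of 1 \<omega>] by simp
        then have "ennreal (max 0 (- (fst (p n) + snd (p n) - D 1 \<omega>)))
          \<le> ennreal (max 0 (- fst (p n)) + D 1 \<omega>)"
          using a by (intro ennreal_leI) auto
        then show "ennreal (max 0 (- (fst (p n) + snd (p n) - D 1 \<omega>)))
          \<le> ennreal (max 0 (- fst (p n))) + ennreal (D 1 \<omega>)"
          using D by (subst (asm) ennreal_plus) auto
      qed
      also have "\<dots> = ennreal (max 0 (- fst (p n))) + ennreal (expectation (D 1))"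
        by (subst nn_integral_add) (auto simp: nn_integral_demand emeasure_space_1 simp del: One_nat_def)
      finally show "after_demand (\<lambda>y. ennreal (max 0 (- y))) (fst (p n) + snd (p n))
          \<le> ennreal (max 0 (- fst (p n))) + ennreal (expectation (D 1))" .
    qed
    also have "\<dots> = (\<integral>\<^sup>+p. ennreal (max 0 (- fst (p n))) \<partial>path_measure \<pi> x) + ennreal (expectation (D 1))"
      by (subst nn_integral_add, measurable) (simp add: P.emeasure_space_1)
    also have "\<dots> \<le> ennreal (\<bar>x\<bar> + n * expectation (D 1)) + ennreal (expectation (D 1))"
      by (intro add_right_mono Suc)
    also have "\<dots> = ennreal (\<bar>x\<bar> + Suc n * expectation (D 1))"
      using ED by (subst ennreal_plus[symmetric]) (auto simp: algebra_simps)
    finally show ?case .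
  }
qed

text \<open>
  The growth condition forces \<open>\<alpha>\<^sup>n E F(x\<^sub>n) \<longlongrightarrow> 0\<close> under every policy: ordering only pushes the state up, so
  \<open>E x\<^sub>n\<^sup>-\<close> is at most \<open>\<bar>x\<bar> + n E D\<close>.
\<close>

lemma le_policy_value:
  assumes \<alpha>: "0 < \<alpha>" "\<alpha> < 1" and pi: "\<pi> \<in> policies" and x: "x \<in> X"
    and F[measurable]: "F \<in> borel_measurable state_space"
    and sub: "\<And>y a. y \<in> X \<Longrightarrow> a \<in> X \<Longrightarrow> 0 \<le> a \<Longrightarrow>
      F y \<le> ennreal (cost y a) + ennreal \<alpha> * after_demand F (y + a)"
    and growth: "\<And>y. y \<in> X \<Longrightarrow> F y \<le> ennreal (B + k * max 0 (- y))" and "B \<ge> 0" "k \<ge> 0"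
  shows "F x \<le> policy_value \<alpha> \<pi> x"
proof -
  let ?P = "path_measure \<pi> x"
  let ?c = "\<lambda>t. \<integral>\<^sup>+p. ennreal (cost (fst (p t)) (snd (p t))) \<partial>?P"
  interpret P: prob_space ?P by (rule prob_space_path_measure[OF pi x])
  note [measurable] = measurable_compose[OF measurable_path_component[OF pi x] measurable_cost]
  have comp: "p t \<in> X \<times> {a \<in> X. 0 \<le> a}" if "p \<in> space ?P" for p t
    using that by (auto simp: space_path_measure[OF pi x])
  have st[measurable]: "(\<lambda>p. fst (p n)) \<in> ?P \<rightarrow>\<^sub>M state_space" for n
    by (rule measurable_compose[OF measurable_path_component[OF pi x]]) simp
  have [measurable]: "(\<lambda>p. after_demand F (fst (p n) + snd (p n))) \<in> borel_measurable ?P" for n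
    using measurable_compose[OF measurable_path_component[OF pi x]
      measurable_compose[OF measurable_order_up_to measurable_after_demand[OF F]]] .
  have [measurable]: "(\<lambda>p. ennreal (max 0 (- fst (p n)))) \<in> borel_measurable ?P" for n
    by (rule measurable_compose[OF st measurable_state_ennreal]) simp
  have ED: "expectation (D 1) \<ge> 0"
    using D_nonneg by (intro integral_nonneg_AE) auto
  \<comment> \<open>Unrolling \<open>sub\<close> over \<open>n\<close> periods leaves their
    discounted cost plus a discounted terminal value of \<open>F\<close>.\<close>
  have step: "F x \<le> (\<Sum>t<n. ennreal (\<alpha> ^ t) * ?c t) + ennreal (\<alpha> ^ n) * (\<integral>\<^sup>+p. F (fst (p n)) \<partial>?P)" for n
  proof (induction n)
    case 0
    show ?case by (simp add: nn_integral_path_0[OF pi x F])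
  next
    case (Suc n)
    have "(\<integral>\<^sup>+p. F (fst (p n)) \<partial>?P) \<le>
        (\<integral>\<^sup>+p. ennreal (cost (fst (p n)) (snd (p n))) + ennreal \<alpha> * after_demand F (fst (p n) + snd (p n)) \<partial>?P)"
      using comp by (intro nn_integral_mono sub) (auto simp: mem_Times_iff)
    also have "\<dots> = ?c n + ennreal \<alpha> * (\<integral>\<^sup>+p. F (fst (p (Suc n))) \<partial>?P)"
      by (subst nn_integral_path_Suc[OF pi x F], subst nn_integral_add) (auto simp: nn_integral_cmult)
    finally have "ennreal (\<alpha> ^ n) * (\<integral>\<^sup>+p. F (fst (p n)) \<partial>?P) \<le>
        ennreal (\<alpha> ^ n) * (?c n + ennreal \<alpha> * (\<integral>\<^sup>+p. F (fst (p (Suc n))) \<partial>?P))"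
      by (rule mult_left_mono) simp
    also have "\<dots> = ennreal (\<alpha> ^ n) * ?c n + ennreal (\<alpha> ^ Suc n) * (\<integral>\<^sup>+p. F (fst (p (Suc n))) \<partial>?P)"
      using \<alpha> by (simp add: distrib_left ennreal_mult mult.assoc[symmetric] mult.commute)
    finally show ?case
      using Suc.IH by (simp add: add.assoc) (meson add_left_mono order_trans)
  qed
  have bound: "F x \<le> policy_value \<alpha> \<pi> x + ennreal (\<alpha> ^ n * (B + k * (\<bar>x\<bar> + n * expectation (D 1))))" for n
  proof -
    have "(\<integral>\<^sup>+p. F (fst (p n)) \<partial>?P) \<le> (\<integral>\<^sup>+p. ennreal B + ennreal k * ennreal (max 0 (- fst (p n))) \<partial>?P)"
    proof (rule nn_integral_mono)
      fix p assume "p \<in> space ?P"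
      then have "F (fst (p n)) \<le> ennreal (B + k * max 0 (- fst (p n)))" using comp[of p n] by (intro growth) auto
      also have "\<dots> = ennreal B + ennreal k * ennreal (max 0 (- fst (p n)))"
        using \<open>B \<ge> 0\<close> \<open>k \<ge> 0\<close> by (simp add: ennreal_plus ennreal_mult)
      finally show "F (fst (p n)) \<le> ennreal B + ennreal k * ennreal (max 0 (- fst (p n)))" .
    qed
    also have "\<dots> = ennreal B + ennreal k * (\<integral>\<^sup>+p. ennreal (max 0 (- fst (p n))) \<partial>?P)"
      by (subst nn_integral_add, measurable, subst nn_integral_cmult, measurable)
         (simp add: P.emeasure_space_1)
    also have "\<dots> \<le> ennreal B + ennreal k * ennreal (\<bar>x\<bar> + n * expectation (D 1))"
      by (intro add_left_mono mult_left_mono nn_integral_path_negative_part[OF pi x]) simp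
    also have "\<dots> = ennreal (B + k * (\<bar>x\<bar> + n * expectation (D 1)))"
      using \<open>B \<ge> 0\<close> \<open>k \<ge> 0\<close> ED by (simp add: ennreal_plus ennreal_mult del: ennreal_plus[symmetric])
    finally have "ennreal (\<alpha> ^ n) * (\<integral>\<^sup>+p. F (fst (p n)) \<partial>?P) \<le>
        ennreal (\<alpha> ^ n) * ennreal (B + k * (\<bar>x\<bar> + n * expectation (D 1)))"
      by (rule mult_left_mono) simp
    also have "\<dots> = ennreal (\<alpha> ^ n * (B + k * (\<bar>x\<bar> + n * expectation (D 1))))"
      using \<alpha> \<open>B \<ge> 0\<close> \<open>k \<ge> 0\<close> ED by (intro ennreal_mult[symmetric]) auto
    finally have 1: "ennreal (\<alpha> ^ n) * (\<integral>\<^sup>+p. F (fst (p n)) \<partial>?P) \<le> \<dots>" .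
    have 2: "(\<Sum>t<n. ennreal (\<alpha> ^ t) * ?c t) \<le> policy_value \<alpha> \<pi> x"
      unfolding policy_value_suminf[OF \<alpha>(1) pi x] by (rule sum_le_suminf) auto
    show ?thesis
      using step[of n] add_mono[OF 2 1] by (rule order_trans)
  qed
  \<comment> \<open>The remainder splits into a geometric term and a multiple of
    \<open>n * \<alpha> ^ n\<close>, and both vanish in the limit.\<close>
  have "(\<lambda>n. \<alpha> ^ n * (B + k * (\<bar>x\<bar> + n * expectation (D 1)))) =
    (\<lambda>n. (B + k * \<bar>x\<bar>) * \<alpha> ^ n + k * expectation (D 1) * (n * \<alpha> ^ n))"
    by (auto simp: algebra_simps)
  moreover have "\<dots> \<longlonglongrightarrow> (B + k * \<bar>x\<bar>) * 0 + k * expectation (D 1) * 0"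
    using \<alpha> by (intro tendsto_intros LIMSEQ_realpow_zero powser_times_n_limit_0) auto
  ultimately have "(\<lambda>n. \<alpha> ^ n * (B + k * (\<bar>x\<bar> + n * expectation (D 1)))) \<longlonglongrightarrow> 0"
    by simp
  then have "(\<lambda>n. policy_value \<alpha> \<pi> x + ennreal (\<alpha> ^ n * (B + k * (\<bar>x\<bar> + n * expectation (D 1)))))
      \<longlonglongrightarrow> policy_value \<alpha> \<pi> x + ennreal 0"
    by (intro tendsto_add tendsto_const tendsto_ennrealI)
  then have "F x \<le> policy_value \<alpha> \<pi> x + ennreal 0"
    by (rule LIMSEQ_le_const) (intro exI allI impI bound)
  then show ?thesis by simp
qed

text \<open>Unrolling \<open>super\<close> gives the reverse of the previous estimate. Here the
  terminal term can simply be dropped, being nonnegative, so every partial sum of the expected costs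
  is at most \<open>F x\<close>. The value \<top> is allowed for \<open>F\<close> and will be used
  to exclude high states.\<close>

lemma policy_value_stationary_le:
  assumes \<alpha>: "0 < \<alpha>" and pol: "stationary_policy \<phi> \<in> policies" and x: "x \<in> X"
    and phi[measurable]: "\<phi> \<in> state_space \<rightarrow>\<^sub>M action_space"
    and F[measurable]: "F \<in> borel_measurable state_space"
    and super: "\<And>y. y \<in> X \<Longrightarrow>
      ennreal (cost y (\<phi> y)) + ennreal \<alpha> * after_demand F (y + \<phi> y) \<le> F y"
  shows "policy_value \<alpha> (stationary_policy \<phi>) x \<le> F x"
proof -
  let ?P = "path_measure (stationary_policy \<phi>) x"
  let ?c = "\<lambda>t. \<integral>\<^sup>+p. ennreal (cost (fst (p t)) (snd (p t))) \<partial>?P"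
  note mc = measurable_path_component[OF pol x]
  note [measurable] = measurable_compose[OF mc measurable_cost]
  have st[measurable]: "(\<lambda>p. fst (p n)) \<in> ?P \<rightarrow>\<^sub>M state_space" for n
    by (rule measurable_compose[OF mc]) simp
  have ad: "(\<lambda>z. after_demand F (fst z + snd z)) \<in> borel_measurable pair_space"
    by (rule measurable_compose[OF measurable_order_up_to measurable_after_demand[OF F]])
  have adn[measurable]: "(\<lambda>p. after_demand F (fst (p n) + snd (p n))) \<in> borel_measurable ?P" for n
    using measurable_compose[OF mc ad] .
  have m: "(\<lambda>z. ennreal (cost (fst z) (snd z)) + ennreal \<alpha> * after_demand F (fst z + snd z))
      \<in> borel_measurable pair_space"
    using ad by measurable
  have step: "(\<Sum>t<n. ennreal (\<alpha> ^ t) * ?c t) + ennreal (\<alpha> ^ n) * (\<integral>\<^sup>+p. F (fst (p n)) \<partial>?P) \<le> F x" for n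
  proof (induction n)
    case 0
    show ?case by (simp add: nn_integral_path_0[OF pol x F])
  next
    case (Suc n)
    have "?c n + ennreal \<alpha> * (\<integral>\<^sup>+p. F (fst (p (Suc n))) \<partial>?P) =
        (\<integral>\<^sup>+p. ennreal (cost (fst (p n)) (snd (p n))) + ennreal \<alpha> * after_demand F (fst (p n) + snd (p n)) \<partial>?P)"
      by (subst nn_integral_path_Suc[OF pol x F], subst nn_integral_add) (auto simp: nn_integral_cmult)
    also have "\<dots> = (\<integral>\<^sup>+p. ennreal (cost (fst (p n)) (\<phi> (fst (p n)))) +
        ennreal \<alpha> * after_demand F (fst (p n) + \<phi> (fst (p n))) \<partial>?P)"
      using nn_integral_path_stationary[OF pol x phi m, of n] by simp
    also have "\<dots> \<le> (\<integral>\<^sup>+p. F (fst (p n)) \<partial>?P)"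
      using measurable_space[OF st] by (intro nn_integral_mono super) auto
    finally have "ennreal (\<alpha> ^ n) * (?c n + ennreal \<alpha> * (\<integral>\<^sup>+p. F (fst (p (Suc n))) \<partial>?P))
        \<le> ennreal (\<alpha> ^ n) * (\<integral>\<^sup>+p. F (fst (p n)) \<partial>?P)"
      by (rule mult_left_mono) simp
    moreover have "ennreal (\<alpha> ^ n) * (?c n + ennreal \<alpha> * (\<integral>\<^sup>+p. F (fst (p (Suc n))) \<partial>?P)) =
        ennreal (\<alpha> ^ n) * ?c n + ennreal (\<alpha> ^ Suc n) * (\<integral>\<^sup>+p. F (fst (p (Suc n))) \<partial>?P)"
      using \<alpha> by (simp add: distrib_left ennreal_mult mult.assoc[symmetric] mult.commute)
    ultimately show ?case
      using Suc.IH by (simp add: add.assoc) (meson add_left_mono order_trans)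
  qed
  have "(\<Sum>t<n. ennreal (\<alpha> ^ t) * ?c t) \<le> F x" for n
    using step[of n] by (rule order_trans[rotated]) simp
  then show ?thesis
    unfolding policy_value_suminf[OF \<alpha> pol x] by (intro suminf_le_const) auto
qed

end

section \<open>Discounted fixed point equations\<close>

text \<open>Starting from the bound \<open>B\<close>, repeated use of \<open>step\<close> gives the
  bound \<open>\<alpha> ^ n * max 0 B\<close>, which tends to 0. This is a one-sided comparison
  principle for discounted recursions; the set \<open>A\<close> allows it to be run on a half-line
  that the dynamics cannot leave.\<close>

lemma contraction_nonpos:
  fixes f :: "'a \<Rightarrow> real"
  assumes \<alpha>: "0 \<le> \<alpha>" "\<alpha> < 1" and bdd: "\<And>x. x \<in> A \<Longrightarrow> f x \<le> B"
    and step: "\<And>m x. 0 \<le> m \<Longrightarrow> (\<And>y. y \<in> A \<Longrightarrow> f y \<le> m) \<Longrightarrow> x \<in> A \<Longrightarrow> f x \<le> \<alpha> * m"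
    and "x \<in> A"
  shows "f x \<le> 0"
proof -
  have bound: "f y \<le> \<alpha> ^ n * max 0 B" if "y \<in> A" for y n
    using that
  proof (induction n arbitrary: y)
    case 0
    then show ?case using bdd[of y] by auto
  next
    case (Suc n)
    have "f y \<le> \<alpha> * (\<alpha> ^ n * max 0 B)"
      by (rule step) (use \<alpha> Suc in auto)
    then show ?case by simp
  qed
  have "(\<lambda>n. \<alpha> ^ n * max 0 B) \<longlonglongrightarrow> 0 * max 0 B"
    using \<alpha> by (intro tendsto_intros LIMSEQ_realpow_zero)
  then have "(\<lambda>n. \<alpha> ^ n * max 0 B) \<longlonglongrightarrow> 0" by simp
  then show ?thesis
    by (rule LIMSEQ_le_const) (use bound[OF \<open>x \<in> A\<close>] in auto)
qed

context inventory_model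
begin

lemma closed_X: "closed X"
  using X_cases closed_Ints by auto

text \<open>Only the compact set \<open>X \<inter> {a..b}\<close> matters, because it contains the
  sublevel set of \<open>x0\<close>.\<close>

lemma attains_min:
  assumes f: "continuous_on X f" and x0: "x0 \<in> X"
    and sub: "\<And>x. x \<in> X \<Longrightarrow> f x \<le> f x0 \<Longrightarrow> a \<le> x \<and> x \<le> b"
  shows "\<exists>z\<in>X. \<forall>x\<in>X. f z \<le> (f x :: real)"
proof -
  let ?A = "X \<inter> {a..b}"
  have "compact ?A" by (intro closed_Int_compact closed_X compact_Icc)
  moreover have "x0 \<in> ?A" using x0 sub[of x0] by auto
  moreover have "continuous_on ?A f" using f by (rule continuous_on_subset) auto
  ultimately obtain z where z: "z \<in> ?A" "\<And>x. x \<in> ?A \<Longrightarrow> f z \<le> f x"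
    using continuous_attains_inf[of ?A f] by blast
  have "f z \<le> f x" if "x \<in> X" for x
    using z(2)[of x] z(2)[OF \<open>x0 \<in> ?A\<close>] sub[OF that] that by force
  then show ?thesis using z(1) by auto
qed

section \<open>Averages over the demand and a contraction principle\<close>

definition bdd_measurable :: "(real \<Rightarrow> real) \<Rightarrow> bool" where
  "bdd_measurable f \<longleftrightarrow> f \<in> borel_measurable state_space \<and> (\<exists>B. \<forall>y\<in>X. \<bar>f y\<bar> \<le> B)"

lemma bdd_measurableI:
  "f \<in> borel_measurable state_space \<Longrightarrow> (\<And>y. y \<in> X \<Longrightarrow> \<bar>f y\<bar> \<le> B) \<Longrightarrow> bdd_measurable f"
  by (auto simp: bdd_measurable_def)

lemma bdd_measurable_0: "bdd_measurable (\<lambda>_. 0)"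
  by (rule bdd_measurableI[of _ 0]) auto

lemma measurable_mean:
  assumes "f \<in> borel_measurable state_space"
  shows "mean f \<in> borel_measurable state_space"
proof -
  have "(\<lambda>(y, \<omega>). f (y - D 1 \<omega>)) \<in> borel_measurable (state_space \<Otimes>\<^sub>M M)"
    using measurable_compose[OF measurable_demand assms, of 1] by (simp add: split_beta')
  then show ?thesis by (rule borel_measurable_lebesgue_integral)
qed

lemma integrable_bdd_measurable:
  assumes "bdd_measurable f" "x \<in> X"
  shows "integrable M (\<lambda>\<omega>. f (x - D 1 \<omega>))"
proof -
  obtain B where "f \<in> borel_measurable state_space" "\<And>y. y \<in> X \<Longrightarrow> \<bar>f y\<bar> \<le> B"
    using assms by (auto simp: bdd_measurable_def)
  then show ?thesis
    using measurable_compose[OF measurable_demand'[OF \<open>x \<in> X\<close>], of 1 f borel] minus_demand_in_X[OF \<open>x \<in> X\<close>]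
    by (intro integrable_const_bound[of _ B]) auto
qed

text \<open>A coupling: both states are hit by the same demand \<open>d\<close>, and the pointwise
  comparison is integrated.\<close>

lemma mean_le_mean:
  assumes "bdd_measurable f" "bdd_measurable k" "x \<in> X" "y \<in> X"
    and le: "\<And>d. 0 \<le> d \<Longrightarrow> x - d \<in> X \<Longrightarrow> y - d \<in> X \<Longrightarrow> f (x - d) \<le> k (y - d) + b"
  shows "mean f x \<le> mean k y + b"
proof -
  note int = integrable_bdd_measurable[OF assms(1,3)] integrable_bdd_measurable[OF assms(2,4)]
  have "mean f x \<le> expectation (\<lambda>\<omega>. k (y - D 1 \<omega>) + b)"
    using int by (rule integral_mono[OF _ Bochner_Integration.integrable_add])
      (auto intro!: le minus_demand_in_X assms(3,4) D_nonneg)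
  also have "\<dots> = mean k y + b"
    using int by (simp add: prob_space)
  finally show ?thesis .
qed

lemma mean_le_const:
  assumes "bdd_measurable f" "x \<in> X" "\<And>y. y \<le> x \<Longrightarrow> y \<in> X \<Longrightarrow> f y \<le> b"
  shows "mean f x \<le> b"
  using mean_le_mean[OF assms(1) bdd_measurable_0 assms(2) assms(2), of b] assms(3) by simp

lemma mean_ge_const:
  assumes "bdd_measurable f" "x \<in> X" "\<And>y. y \<le> x \<Longrightarrow> y \<in> X \<Longrightarrow> b \<le> f y"
  shows "b \<le> mean f x"
  using mean_le_mean[OF bdd_measurable_0 assms(1) assms(2) assms(2), of "- b"] assms(3) by simp

lemma mean_continuous:
  assumes "bdd_measurable f" and f: "continuous_on X f"
  shows "continuous_on X (mean f)"
proof (rule continuous_on_sequentiallyI)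
  fix xs x assume xs: "\<forall>n. xs n \<in> X" and x: "x \<in> X" and lim: "xs \<longlonglongrightarrow> x"
  obtain B where B: "\<And>y. y \<in> X \<Longrightarrow> \<bar>f y\<bar> \<le> B"
    using assms by (auto simp: bdd_measurable_def)
  show "(\<lambda>n. mean f (xs n)) \<longlonglongrightarrow> mean f x"
  proof (rule integral_dominated_convergence[where w = "\<lambda>_. B"])
    show "AE \<omega> in M. (\<lambda>n. f (xs n - D 1 \<omega>)) \<longlonglongrightarrow> f (x - D 1 \<omega>)"
    proof (rule AE_I2)
      fix \<omega> assume "\<omega> \<in> space M"
      then have "x - D 1 \<omega> \<in> X" "\<And>n. xs n - D 1 \<omega> \<in> X"
        using xs x minus_demand_in_X by auto
      then show "(\<lambda>n. f (xs n - D 1 \<omega>)) \<longlonglongrightarrow> f (x - D 1 \<omega>)"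
        using f lim by (intro continuous_on_tendsto_compose[OF f]) (auto intro!: tendsto_intros)
    qed
    show "AE \<omega> in M. norm (f (xs n - D 1 \<omega>)) \<le> B" for n
      using xs minus_demand_in_X B by auto
  qed (use xs x integrable_bdd_measurable[OF assms(1)] in auto)
qed

text \<open>Banach iteration in the sup norm over \<open>X\<close>: averaging and \<Phi> are
  nonexpansive, so the operator contracts with factor \<alpha>. Continuity is a conditional
  conclusion because an operator with a case split, such as the one defining \<open>H\<close> later,
  need not preserve it.\<close>

lemma discounted_fixpoint:
  fixes \<Phi> :: "real \<Rightarrow> real \<Rightarrow> real"
  assumes \<alpha>: "0 \<le> \<alpha>" "\<alpha> < 1"
    and lip: "\<And>x e e'. x \<in> X \<Longrightarrow> \<bar>\<Phi> x e - \<Phi> x e'\<bar> \<le> \<bar>e - e'\<bar>"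
    and bound: "\<And>x. x \<in> X \<Longrightarrow> \<bar>\<Phi> x 0\<bar> \<le> B"
    and meas: "\<And>f. f \<in> borel_measurable state_space \<Longrightarrow> (\<lambda>x. \<Phi> x (f x)) \<in> borel_measurable state_space"
  obtains f where "bdd_measurable f" "\<And>x. x \<in> X \<Longrightarrow> f x = \<Phi> x (\<alpha> * mean f x)"
    "(\<And>k. bdd_measurable k \<Longrightarrow> continuous_on X k \<Longrightarrow> continuous_on X (\<lambda>x. \<Phi> x (\<alpha> * mean k x)))
      \<Longrightarrow> continuous_on X f"
proof -
  define T where "T = (\<lambda>k x. \<Phi> x (\<alpha> * mean k x))"
  define F where "F n = (T ^^ n) (\<lambda>_. 0)" for n
  have F0: "F 0 = (\<lambda>_. 0)" and FS: "F (Suc n) = T (F n)" for n by (simp_all add: F_def)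
  have Tm: "T k \<in> borel_measurable state_space" if "k \<in> borel_measurable state_space" for k
    unfolding T_def by (intro meas borel_measurable_times measurable_mean that) auto
  have Fm: "F n \<in> borel_measurable state_space" for n
    by (induction n) (auto simp: F0 FS intro: Tm)
  have T_contr: "\<bar>T k x - T k' x\<bar> \<le> \<alpha> * e"
    if "bdd_measurable k" "bdd_measurable k'" "x \<in> X" "\<And>y. y \<in> X \<Longrightarrow> \<bar>k y - k' y\<bar> \<le> e" for k k' x e
  proof -
    have "mean k x \<le> mean k' x + e" "mean k' x \<le> mean k x + e"
      using that(4) by (intro mean_le_mean that(1-3); force simp: abs_le_iff algebra_simps)+
    then have "\<bar>mean k x - mean k' x\<bar> \<le> e" by linarith
    then have "\<bar>\<alpha> * mean k x - \<alpha> * mean k' x\<bar> \<le> \<alpha> * e"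
      using \<alpha> by (metis abs_mult abs_of_nonneg mult_left_mono right_diff_distrib)
    then show ?thesis unfolding T_def using lip[OF that(3)] order_trans by blast
  qed
  have diff: "bdd_measurable (F n) \<and> (\<forall>x\<in>X. \<bar>F (Suc n) x - F n x\<bar> \<le> \<alpha> ^ n * B)" for n
  proof (induction n)
    case 0
    show ?case using bound by (simp add: F0 FS bdd_measurable_0 T_def)
  next
    case (Suc n)
    then obtain b where b: "\<And>x. x \<in> X \<Longrightarrow> \<bar>F n x\<bar> \<le> b" by (auto simp: bdd_measurable_def)
    have "bdd_measurable (F (Suc n))"
    proof (rule bdd_measurableI[OF Fm])
      fix x assume "x \<in> X"
      then show "\<bar>F (Suc n) x\<bar> \<le> b + \<alpha> ^ n * B"
        using Suc b[of x] by (force simp: abs_le_iff)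
    qed
    moreover have "\<bar>F (Suc (Suc n)) x - F (Suc n) x\<bar> \<le> \<alpha> * (\<alpha> ^ n * B)" if "x \<in> X" for x
      using T_contr[OF calculation _ that, of "F n" "\<alpha> ^ n * B"] Suc unfolding FS by blast
    ultimately show ?case by (simp add: mult.assoc)
  qed
  \<comment> \<open>The limit of the iterates is written as a telescoping series, so that the M-test
    yields uniform convergence.\<close>
  define f where "f x = (\<Sum>i. F (Suc i) x - F i x)" for x
  have "uniform_limit X (\<lambda>n x. \<Sum>i<n. F (Suc i) x - F i x) f sequentially"
    unfolding f_def
  proof (rule Weierstrass_m_test)
    show "summable (\<lambda>n. \<alpha> ^ n * B)" using \<alpha> by (intro summable_mult2 summable_geometric) auto
  qed (use diff in auto)
  moreover have "(\<Sum>i<n. F (Suc i) x - F i x) = F n x" for n x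
    using sum_lessThan_telescope[of "\<lambda>i. F i x" n] by (simp add: F0)
  ultimately have unif: "uniform_limit X F f sequentially"
    by simp
  have close: "\<exists>n0. \<forall>n\<ge>n0. \<forall>x\<in>X. \<bar>F n x - f x\<bar> \<le> e" if "e > 0" for e
    using uniform_limitD[OF unif that] unfolding eventually_sequentially dist_real_def
    by (meson less_imp_le)
  have fm: "f \<in> borel_measurable state_space"
  proof (rule borel_measurable_LIMSEQ_real)
    show "F n \<in> borel_measurable state_space" for n by (rule Fm)
    show "(\<lambda>n. F n x) \<longlonglongrightarrow> f x" if "x \<in> space state_space" for x
      using tendsto_uniform_limitI[OF unif] that by simp
  qed
  have fb: "bdd_measurable f"
  proof -
    obtain n where n: "\<And>x. x \<in> X \<Longrightarrow> \<bar>F n x - f x\<bar> \<le> 1" using close[of 1] by auto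
    obtain b where b: "\<And>x. x \<in> X \<Longrightarrow> \<bar>F n x\<bar> \<le> b" using diff[of n] by (auto simp: bdd_measurable_def)
    show ?thesis
      by (rule bdd_measurableI[OF fm, of "b + 1"]) (use n b in \<open>force simp: abs_le_iff\<close>)
  qed
  have fix_eq: "f x = T f x" if x: "x \<in> X" for x
  proof -
    have "\<bar>f x - T f x\<bar> \<le> 0 + e" if e: "e > 0" for e
    proof -
      obtain n where n: "\<And>y m. y \<in> X \<Longrightarrow> m \<ge> n \<Longrightarrow> \<bar>F m y - f y\<bar> \<le> e / 2"
        using close[of "e / 2"] e by auto
      have "\<bar>F (Suc n) x - T f x\<bar> \<le> \<alpha> * (e / 2)"
        unfolding FS using diff fb x n by (intro T_contr) auto
      moreover have "\<alpha> * (e / 2) \<le> e / 2" using \<alpha> e by (simp add: mult_left_le_one_le)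
      moreover have "\<bar>F (Suc n) x - f x\<bar> \<le> e / 2" using n[OF x, of "Suc n"] by simp
      ultimately show ?thesis by linarith
    qed
    then have "\<bar>f x - T f x\<bar> \<le> 0" by (rule field_le_epsilon)
    then show ?thesis by simp
  qed
  have cont: "continuous_on X f"
    if k: "\<And>k. bdd_measurable k \<Longrightarrow> continuous_on X k \<Longrightarrow> continuous_on X (\<lambda>x. \<Phi> x (\<alpha> * mean k x))"
  proof (rule uniform_limit_theorem[OF _ unif])
    have "continuous_on X (F n)" for n
    proof (induction n)
      case (Suc n)
      show ?case unfolding FS T_def by (rule k) (use diff Suc in auto)
    qed (simp add: F0)
    then show "\<forall>\<^sub>F n in sequentially. continuous_on X (F n)" by simp
  qed simp
  show thesis
    by (rule that[OF fb _ cont]) (use fix_eq in \<open>auto simp: T_def\<close>)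
qed

end

section \<open>The critical level\<close>

text \<open>Here \<open>g\<close> stands for \<open>Eh_disc \<alpha>\<close>, and
  \<open>mean_h\<close> expresses the holding cost through it. Quasiconvexity enters as monotonicity
  on either side of a minimizer \<open>y0\<close>, hypothesis (ii) as the point \<open>N\<close>,
  and coercivity on the right as \<open>g_right\<close>.\<close>

locale quasiconvex_inventory = inventory_model +
  fixes \<alpha> :: real and g :: "real \<Rightarrow> real" and y0 N :: real
  assumes \<alpha>: "0 < \<alpha>" "\<alpha> < 1"
    and mean_h: "\<And>y. y \<in> X \<Longrightarrow> mean h y = g y - (1 - \<alpha>) * cbar * y - \<alpha> * cbar * expectation (D 1)"
    and g_cont: "continuous_on X g"
    and y0: "y0 \<in> X"
    and g_decreasing: "\<And>x y. x \<in> X \<Longrightarrow> y \<in> X \<Longrightarrow> x \<le> y \<Longrightarrow> y \<le> y0 \<Longrightarrow> g y \<le> g x"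
    and g_increasing: "\<And>x y. x \<in> X \<Longrightarrow> y \<in> X \<Longrightarrow> y0 \<le> x \<Longrightarrow> x \<le> y \<Longrightarrow> g x \<le> g y"
    and g_left: "\<And>y. y \<in> X \<Longrightarrow> y < N \<Longrightarrow> g y0 + K < g y"
    and g_right: "\<And>B. \<exists>b\<in>X. \<forall>y\<in>X. b \<le> y \<longrightarrow> B \<le> g y"
begin

lemma g_min: "y \<in> X \<Longrightarrow> g y0 \<le> g y"
  using g_decreasing[of y y0] g_increasing[of y0 y] y0 by linarith

lemma g_measurable: "g \<in> borel_measurable state_space"
  unfolding state_space_def by (rule borel_measurable_continuous_on_restrict[OF g_cont])

definition J :: "real \<Rightarrow> (real \<Rightarrow> real) \<Rightarrow> real \<Rightarrow> real" where
  "J c u x = g x - c + \<alpha> * mean u x"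

text \<open>
  The value of the auxiliary problem in which \<open>g - c\<close> is paid in every period until one decides
  to stop, at no cost.
\<close>

definition stopping_value :: "real \<Rightarrow> (real \<Rightarrow> real) \<Rightarrow> bool" where
  "stopping_value c u \<longleftrightarrow>
    bdd_measurable u \<and> continuous_on X u \<and> (\<forall>x\<in>X. u x = min 0 (J c u x))"

lemma stopping_value_exists:
  assumes "g y0 \<le> c"
  shows "\<exists>u. stopping_value c u"
proof -
  note [measurable] = g_measurable
  obtain u where "bdd_measurable u" "\<And>x. x \<in> X \<Longrightarrow> u x = min 0 (g x - c + \<alpha> * mean u x)"
    "(\<And>k. bdd_measurable k \<Longrightarrow> continuous_on X k \<Longrightarrow>
      continuous_on X (\<lambda>x. min 0 (g x - c + \<alpha> * mean k x))) \<Longrightarrow> continuous_on X u"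
  \<comment> \<open>At \<open>e = 0\<close> the map takes values between \<open>g y0 - c\<close> and
    0, whence \<open>B\<close>.\<close>
  proof (rule discounted_fixpoint[where \<alpha> = \<alpha> and \<Phi> = "\<lambda>x e. min 0 (g x - c + e)" and B = "c - g y0"])
    show "\<bar>min 0 (g x - c + 0)\<bar> \<le> c - g y0" if "x \<in> X" for x
      using g_min[OF that] assms by (auto simp: min_def)
    show "(\<lambda>x. min 0 (g x - c + f x)) \<in> borel_measurable state_space"
      if [measurable]: "f \<in> borel_measurable state_space" for f
      by measurable
  qed (use \<alpha> in auto)
  moreover have "continuous_on X (\<lambda>x. min 0 (g x - c + \<alpha> * mean k x))"
    if "bdd_measurable k" "continuous_on X k" for k
    by (intro continuous_intros mean_continuous that g_cont)
  ultimately show ?thesis unfolding stopping_value_def J_def by blast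
qed

lemma stopping_value_nonpos: "stopping_value c u \<Longrightarrow> x \<in> X \<Longrightarrow> u x \<le> 0"
  by (simp add: stopping_value_def)

lemma stopping_value_mean_nonpos: "stopping_value c u \<Longrightarrow> x \<in> X \<Longrightarrow> mean u x \<le> 0"
  by (rule mean_le_const) (auto simp: stopping_value_nonpos, simp add: stopping_value_def)

text \<open>Changing the level alters each period's payment by \<open>c - c'\<close>, so the value
  moves by at most the geometric sum of these changes. Accordingly \<open>?l\<close> solves
  \<open>l = \<bar>c - c'\<bar> + \<alpha> * l\<close>.\<close>

lemma stopping_value_diff:
  assumes u: "stopping_value c u" and u': "stopping_value c' u'" and x: "x \<in> X"
  shows "u x - u' x \<le> \<bar>c - c'\<bar> / (1 - \<alpha>)"
proof -
  let ?l = "\<bar>c - c'\<bar> / (1 - \<alpha>)"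
  have l: "\<bar>c - c'\<bar> + \<alpha> * ?l = ?l" "?l \<ge> 0" using \<alpha> by (auto simp: field_simps)
  obtain B B' where B: "\<And>y. y \<in> X \<Longrightarrow> \<bar>u y\<bar> \<le> B" "\<And>y. y \<in> X \<Longrightarrow> \<bar>u' y\<bar> \<le> B'"
    using u u' unfolding stopping_value_def bdd_measurable_def by metis
  have "u x - u' x - ?l \<le> 0"
  proof (rule contraction_nonpos[where f = "\<lambda>x. u x - u' x - ?l" and A = X and B = "B + B'" and \<alpha> = \<alpha>])
    show "u y - u' y - ?l \<le> B + B'" if "y \<in> X" for y
      using B[OF that] l by linarith
    fix m y assume m: "0 \<le> m" and le: "\<And>y. y \<in> X \<Longrightarrow> u y - u' y - ?l \<le> m" and y: "y \<in> X"
    have "mean u y \<le> mean u' y + (?l + m)"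
      using u u' y le by (intro mean_le_mean) (force simp: stopping_value_def algebra_simps)+
    then have "\<alpha> * mean u y \<le> \<alpha> * (mean u' y + (?l + m))"
      using \<alpha> by (intro mult_left_mono) auto
    then have "J c u y - J c' u' y \<le> \<bar>c - c'\<bar> + \<alpha> * ?l + \<alpha> * m"
      unfolding J_def by (auto simp: algebra_simps)
    moreover have "0 \<le> \<alpha> * m" using \<alpha> m by simp
    moreover have "u y = min 0 (J c u y)" "u' y = min 0 (J c' u' y)"
      using u u' y by (auto simp: stopping_value_def)
    ultimately show "u y - u' y - ?l \<le> \<alpha> * m" using l by linarith
  qed (use \<alpha> x in auto)
  then show ?thesis by simp
qed

lemma J_diff:
  assumes u: "stopping_value c u" and u': "stopping_value c' u'" and x: "x \<in> X"
  shows "J c u x \<le> J c' u' x + \<bar>c - c'\<bar> / (1 - \<alpha>)"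
proof -
  let ?l = "\<bar>c - c'\<bar> / (1 - \<alpha>)"
  have l: "\<bar>c - c'\<bar> + \<alpha> * ?l = ?l" using \<alpha> by (auto simp: field_simps)
  have "mean u x \<le> mean u' x + ?l"
    using u u' x stopping_value_diff[OF u u']
    by (intro mean_le_mean) (force simp: stopping_value_def algebra_simps)+
  then have "\<alpha> * mean u x \<le> \<alpha> * (mean u' x + ?l)"
    using \<alpha> by (intro mult_left_mono) auto
  then show ?thesis using l unfolding J_def by (simp add: algebra_simps)
qed

text \<open>Demand only lowers the state, so from \<open>x\<close> on every payment
  \<open>g - c\<close> is nonnegative and nothing is gained by continuing.\<close>

lemma stopping_value_eq_0:
  assumes u: "stopping_value c u" and A: "\<And>y. y \<in> X \<Longrightarrow> y \<le> x \<Longrightarrow> c \<le> g y" and x: "x \<in> X"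
  shows "u x = 0"
proof -
  obtain B where B: "\<And>y. y \<in> X \<Longrightarrow> \<bar>u y\<bar> \<le> B"
    using u unfolding stopping_value_def bdd_measurable_def by metis
  have "- u x \<le> 0"
  proof (rule contraction_nonpos[where f = "\<lambda>x. - u x" and A = "X \<inter> {..x}" and B = B and \<alpha> = \<alpha>])
    show "- u y \<le> B" if "y \<in> X \<inter> {..x}" for y using B[of y] that by auto
    fix m y assume m: "0 \<le> m" and le: "\<And>y. y \<in> X \<inter> {..x} \<Longrightarrow> - u y \<le> m" and y: "y \<in> X \<inter> {..x}"
    have "- m \<le> mean u y"
      using u y le by (intro mean_ge_const) (force simp: stopping_value_def)+
    then have "\<alpha> * (- m) \<le> \<alpha> * mean u y" using \<alpha> by (intro mult_left_mono) auto
    then have "J c u y \<ge> - (\<alpha> * m)" using A[of y] y by (simp add: J_def)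
    moreover have "0 \<le> \<alpha> * m" using \<alpha> m by simp
    moreover have "u y = min 0 (J c u y)" using u y by (auto simp: stopping_value_def)
    ultimately show "- u y \<le> \<alpha> * m" by linarith
  qed (use \<alpha> x in auto)
  then show ?thesis using stopping_value_nonpos[OF u x] by simp
qed

lemma J_ge:
  assumes u: "stopping_value c u" and A: "\<And>y. y \<in> X \<Longrightarrow> y \<le> x \<Longrightarrow> c \<le> g y" and x: "x \<in> X"
  shows "g x - c \<le> J c u x"
proof -
  have "u y = 0" if "y \<in> X" "y \<le> x" for y
    using A that by (intro stopping_value_eq_0[OF u]) auto
  then have "0 \<le> mean u x"
    using u x by (intro mean_ge_const) (auto simp: stopping_value_def)
  then show ?thesis using \<alpha> by (simp add: J_def)
qed

text \<open>Since \<open>u\<close> is bounded, \<open>J\<close> inherits from \<open>g\<close> both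
  its lower bound and its growth to the right.\<close>

lemma J_bdd_below:
  assumes u: "stopping_value c u"
  shows "\<exists>B. \<forall>x\<in>X. g x - B \<le> J c u x"
proof -
  obtain B where B: "\<And>y. y \<in> X \<Longrightarrow> \<bar>u y\<bar> \<le> B"
    using u unfolding stopping_value_def bdd_measurable_def by metis
  have "g x - (c + \<alpha> * B) \<le> J c u x" if "x \<in> X" for x
  proof -
    have "- B \<le> mean u x"
      using u that B by (intro mean_ge_const) (force simp: stopping_value_def abs_le_iff)+
    then have "\<alpha> * (- B) \<le> \<alpha> * mean u x" using \<alpha> by (intro mult_left_mono) auto
    then show ?thesis by (simp add: J_def)
  qed
  then show ?thesis by blast
qed

lemma J_bdd_below':
  assumes u: "stopping_value c u"
  shows "bdd_below (J c u ` X)"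
proof -
  obtain B where "\<And>x. x \<in> X \<Longrightarrow> g x - B \<le> J c u x" using J_bdd_below[OF u] by blast
  then have "g y0 - B \<le> J c u x" if "x \<in> X" for x using g_min[OF that] that by force
  then show ?thesis by (auto intro!: bdd_belowI2)
qed

lemma critical_level:
  obtains c u S where "g y0 \<le> c" "c \<le> g y0 + K" "stopping_value c u" "S \<in> X"
    "J c u S = - K" "\<And>x. x \<in> X \<Longrightarrow> - K \<le> J c u x"
proof -
  obtain U where U: "\<And>c. g y0 \<le> c \<Longrightarrow> stopping_value c (U c)"
    using stopping_value_exists by metis
  define j where "j c = (INF x\<in>X. J c (U c) x)" for c
  have ne: "X \<noteq> {}" using y0 by auto
  have j_le: "j c \<le> J c (U c) x" if "g y0 \<le> c" "x \<in> X" for c x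
    unfolding j_def using J_bdd_below'[OF U[OF that(1)]] that by (intro cINF_lower)
  \<comment> \<open>The shift in \<open>J_diff\<close> is uniform in \<open>x\<close>, so it passes
    to the infimum.\<close>
  have j_diff: "j c \<le> j c' + 1 / (1 - \<alpha>) * \<bar>c - c'\<bar>" if "g y0 \<le> c" "g y0 \<le> c'" for c c'
  proof -
    have "j c - \<bar>c - c'\<bar> / (1 - \<alpha>) \<le> j c'"
      unfolding j_def[of c']
      using j_le[OF that(1)] J_diff[OF U[OF that(1)] U[OF that(2)]]
      by (intro cINF_greatest[OF ne]) (smt (verit))
    then show ?thesis by simp
  qed
  have "(1 / (1 - \<alpha>))-lipschitz_on {g y0 .. g y0 + K} j"
  proof (rule lipschitz_onI)
    fix c c' assume "c \<in> {g y0..g y0 + K}" "c' \<in> {g y0..g y0 + K}"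
    then show "dist (j c) (j c') \<le> 1 / (1 - \<alpha>) * dist c c'"
      using j_diff[of c c'] j_diff[of c' c] by (simp add: dist_real_def abs_minus_commute)
  qed (use \<alpha> in auto)
  then have cont: "continuous_on {g y0 .. g y0 + K} j" by (rule lipschitz_on_continuous_on)
  have hi: "j (g y0 + K) \<le> - K"
  proof -
    have "\<alpha> * mean (U (g y0 + K)) y0 \<le> 0"
      using \<alpha> stopping_value_mean_nonpos[OF U y0, of "g y0 + K"] K_pos by (simp add: mult_le_0_iff)
    then have "J (g y0 + K) (U (g y0 + K)) y0 \<le> - K" by (simp add: J_def)
    then show ?thesis using j_le[OF _ y0, of "g y0 + K"] K_pos by linarith
  qed
  \<comment> \<open>At the level \<open>g y0\<close> no payment is negative, so \<open>J\<close> is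
    nonnegative by \<open>J_ge\<close>.\<close>
  have lo: "- K \<le> j (g y0)"
    unfolding j_def
  proof (rule cINF_greatest[OF ne])
    fix x assume "x \<in> X"
    then show "- K \<le> J (g y0) (U (g y0)) x"
      using J_ge[OF U, of "g y0" x] g_min K_pos by force
  qed
  obtain c where c: "g y0 \<le> c" "c \<le> g y0 + K" and jc: "j c = - K"
    using IVT2'[OF hi lo _ cont] K_pos by auto
  let ?J = "J c (U c)"
  note u = U[OF c(1)]
  \<comment> \<open>The infimum is attained because points with \<open>J < 0\<close> lie in a
    bounded interval: left of \<open>N\<close> one has \<open>J \<ge> g - c > 0\<close>, and from
    \<open>b\<close> on \<open>J \<ge> g - B \<ge> 0\<close>.\<close>
  obtain x0 where x0: "x0 \<in> X" "?J x0 < 0"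
    using cINF_greatest[OF ne, of 0 ?J] jc K_pos unfolding j_def by force
  obtain B where B: "\<And>x. x \<in> X \<Longrightarrow> g x - B \<le> ?J x" using J_bdd_below[OF u] by blast
  obtain b where b: "\<And>x. x \<in> X \<Longrightarrow> b \<le> x \<Longrightarrow> B \<le> g x" using g_right by metis
  have "\<exists>S\<in>X. \<forall>x\<in>X. ?J S \<le> ?J x"
  proof (rule attains_min[OF _ x0(1)])
    show "continuous_on X ?J"
      unfolding J_def using u
      by (intro continuous_intros g_cont mean_continuous) (auto simp: stopping_value_def)
    fix x assume x: "x \<in> X" and "?J x \<le> ?J x0"
    then have neg: "?J x < 0" using x0 by simp
    have "N \<le> x"
    proof (rule ccontr)
      assume "\<not> N \<le> x"
      then have "c < g y" if "y \<in> X" "y \<le> x" for y using g_left[of y] that c by auto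
      then show False using J_ge[OF u _ x] neg x by force
    qed
    moreover have "x \<le> b" using B[OF x] b[OF x] neg by linarith
    ultimately show "N \<le> x \<and> x \<le> b" ..
  qed
  then obtain S where S: "S \<in> X" "\<And>x. x \<in> X \<Longrightarrow> ?J S \<le> ?J x" by blast
  have "?J S \<le> j c" unfolding j_def by (rule cINF_greatest[OF ne S(2)])
  with j_le[OF c(1) S(1)] jc have "?J S = - K" by simp
  then show thesis using that[OF c u S(1)] S(2) by simp
qed

end

section \<open>The cost of the critical policy\<close>

locale critical_inventory = quasiconvex_inventory +
  fixes c :: real and u :: "real \<Rightarrow> real" and S :: real
  assumes c: "g y0 \<le> c" "c \<le> g y0 + K"
    and u: "stopping_value c u"
    and S: "S \<in> X" and J_S: "J c u S = - K" and J_ge_K: "\<And>x. x \<in> X \<Longrightarrow> - K \<le> J c u x"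
begin

text \<open>Expressed through \<open>g\<close> and \<open>c\<close>; agreement with the infimum over
  \<open>G \<alpha>\<close> in the theorem comes from \<open>reorder_set\<close>.\<close>

definition s :: real where "s = Inf {x \<in> X. g x \<le> c}"

text \<open>The sublevel set is closed, as \<open>X\<close> is closed and \<open>g\<close>
  continuous on it, and \<open>N\<close> bounds it from below. Hence it contains its
  infimum.\<close>

lemma s_facts: "s \<in> X" "g s \<le> c" "\<And>x. x \<in> X \<Longrightarrow> g x \<le> c \<Longrightarrow> s \<le> x"
proof -
  let ?A = "X \<inter> g -` {..c}"
  have s: "s = Inf ?A" unfolding s_def by (rule arg_cong[where f = Inf]) auto
  have "closed ?A"
    by (rule continuous_closed_preimage[OF g_cont closed_X]) simp
  moreover have "y0 \<in> ?A" using y0 c by auto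
  moreover have "N \<le> x" if "x \<in> ?A" for x
    using g_left[of x] that c by force
  then have bdd: "bdd_below ?A" by (auto intro!: bdd_belowI)
  ultimately have "s \<in> ?A"
    unfolding s by (intro closed_contains_Inf) auto
  then show "s \<in> X" "g s \<le> c" by auto
  show "s \<le> x" if "x \<in> X" "g x \<le> c" for x
    unfolding s by (rule cInf_lower[OF _ bdd]) (use that in auto)
qed

lemma g_below_s: "x \<in> X \<Longrightarrow> x < s \<Longrightarrow> c < g x"
  using s_facts(3)[of x] by linarith

lemma s_le_S: "s \<le> S"
proof (rule ccontr)
  assume "\<not> s \<le> S"
  then have "c < g y" if "y \<in> X" "y \<le> S" for y using g_below_s that by auto
  then show False using J_ge[OF u _ S] J_S S K_pos by force
qed

lemma u_below_s: "x \<in> X \<Longrightarrow> x < s \<Longrightarrow> u x = 0"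
  by (rule stopping_value_eq_0[OF u]) (use g_below_s in \<open>force intro: less_imp_le\<close>)+

lemma u_ge_K: "x \<in> X \<Longrightarrow> - K \<le> u x"
  using u J_ge_K[of x] K_pos by (simp add: stopping_value_def)

text \<open>The split point of the later comparisons: between \<open>s\<close> and \<open>z\<close>
  one has \<open>J \<le> 0\<close>, so continuing is optimal in the stopping problem, and from
  \<open>z\<close> on \<open>g\<close> is nondecreasing.\<close>

definition z :: real where "z = max y0 S"

lemma z: "z \<in> X" "y0 \<le> z" "S \<le> z"
  using y0 S by (auto simp: z_def max_def)

text \<open>
  For \<open>x\<close> between \<open>y0\<close> and \<open>S\<close>, \<open>g x \<le> g S\<close> and \<open>u\<close> oscillates by at most \<open>K\<close>, so
  \<open>J x \<le> J S + \<alpha> K < 0\<close>.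
\<close>

lemma J_nonpos:
  assumes "x \<in> X" "s \<le> x" "x \<le> z"
  shows "J c u x \<le> 0"
proof (cases "x \<le> y0")
  case True
  have "\<alpha> * mean u x \<le> 0"
    using \<alpha> stopping_value_mean_nonpos[OF u assms(1)] by (simp add: mult_le_0_iff)
  moreover have "g x \<le> c"
    using g_decreasing[OF s_facts(1) assms(1,2) True] s_facts(2) by simp
  ultimately show ?thesis by (simp add: J_def)
next
  case False
  then have "x \<le> S" using assms(3) by (auto simp: z_def split: if_splits)
  then have gx: "g x \<le> g S" using g_increasing[OF assms(1) S] False by auto
  have uK: "u y \<le> u y' + K" if "y \<in> X" "y' \<in> X" for y y'
    using stopping_value_nonpos[OF u that(1)] u_ge_K[OF that(2)] by linarith
  have "mean u x \<le> mean u S + K"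
    using u uK by (intro mean_le_mean assms(1) S) (auto simp: stopping_value_def)
  then have "\<alpha> * mean u x \<le> \<alpha> * (mean u S + K)"
    using \<alpha> by (intro mult_left_mono) auto
  moreover have "\<alpha> * K \<le> K" using \<alpha> K_pos by simp
  ultimately show ?thesis using gx J_S by (simp add: J_def algebra_simps)
qed

lemma u_eq_J: "x \<in> X \<Longrightarrow> s \<le> x \<Longrightarrow> x \<le> z \<Longrightarrow> u x = J c u x"
  using J_nonpos u by (simp add: stopping_value_def)

definition \<phi> :: "real \<Rightarrow> real" where "\<phi> x = (if x < s then S - x else 0)"

lemma measurable_\<phi>: "\<phi> \<in> state_space \<rightarrow>\<^sub>M action_space"
  unfolding state_space_def action_space_def \<phi>_def
  using s_le_S S X_cases
  by (intro measurable_restrict_space2 measurable_restrict_space1)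
     (auto simp: space_restrict_space)

lemma \<phi>_action: "x \<in> X \<Longrightarrow> \<phi> x \<in> X \<and> 0 \<le> \<phi> x"
  using measurable_space[OF measurable_\<phi>, of x] by simp

lemma sS_policy_eq: "sS_policy s S = stationary_policy \<phi>"
  by (simp add: sS_policy_def \<phi>_def[abs_def])

lemma stationary_\<phi>: "stationary_policy \<phi> \<in> policies"
  using sS_policy_in_policies[OF s_le_S S] by (simp add: sS_policy_eq)

end

text \<open>
  \<open>H + c / (1 - \<alpha>)\<close> is the cost of the \<open>(s, S)\<close> policy when \<open>g\<close> is frozen to the right of \<open>b\<close>.
  Freezing makes \<open>H\<close> bounded, and it changes nothing for states below \<open>b\<close>, since from there the
  \<open>(s, S)\<close> policy never exceeds \<open>b\<close>.
\<close>

locale truncated_inventory = critical_inventory +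
  fixes b :: real and H :: "real \<Rightarrow> real"
  assumes b: "b \<in> X" "z \<le> b" "c \<le> g b"
    and H_bdd: "bdd_measurable H"
    and H_eq: "\<And>x. x \<in> X \<Longrightarrow> H x = (if x < s then 0 else g (min x b) - c + \<alpha> * mean H x)"
begin

text \<open>For states up to \<open>b\<close> this is \<open>G \<alpha>\<close> minus the constant
  \<open>c / (1 - \<alpha>)\<close>, see \<open>G_eq\<close>.\<close>

definition JH :: "real \<Rightarrow> real" where
  "JH x = g (min x b) - c + \<alpha> * mean H x"

lemma H_below_s: "x \<in> X \<Longrightarrow> x < s \<Longrightarrow> H x = 0"
  by (simp add: H_eq)

lemma H_above_s: "x \<in> X \<Longrightarrow> s \<le> x \<Longrightarrow> H x = JH x"
  by (simp add: H_eq JH_def)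

lemma u_bdd: "bdd_measurable u"
  using u by (simp add: stopping_value_def)

lemma min_b_in_X: "x \<in> X \<Longrightarrow> min x b \<in> X"
  using b by (auto simp: min_def)

text \<open>In the stopping problem \<open>H\<close> is the value of one particular rule, namely to
  stop below \<open>s\<close>, whereas \<open>u\<close> is the optimal value. Up to \<open>b\<close>
  the truncation of \<open>g\<close> does not show.\<close>

lemma u_le_H:
  assumes "x \<in> X" "x \<le> b"
  shows "u x \<le> H x"
proof -
  obtain B B' where B: "\<And>y. y \<in> X \<Longrightarrow> \<bar>u y\<bar> \<le> B" "\<And>y. y \<in> X \<Longrightarrow> \<bar>H y\<bar> \<le> B'"
    using u_bdd H_bdd unfolding bdd_measurable_def by metis
  have "u x - H x \<le> 0"
  proof (rule contraction_nonpos[where f = "\<lambda>x. u x - H x" and A = "X \<inter> {..b}" and B = "B + B'" and \<alpha> = \<alpha>])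
    show "u y - H y \<le> B + B'" if "y \<in> X \<inter> {..b}" for y
      using B[of y] that by auto
    fix m y assume m: "0 \<le> m" and le: "\<And>y. y \<in> X \<inter> {..b} \<Longrightarrow> u y - H y \<le> m" and y: "y \<in> X \<inter> {..b}"
    show "u y - H y \<le> \<alpha> * m"
    proof (cases "y < s")
      case True
      then show ?thesis using y m \<alpha> u_below_s H_below_s by auto
    next
      case False
      have "mean u y \<le> mean H y + m"
        using y le by (intro mean_le_mean u_bdd H_bdd) (force simp: algebra_simps)+
      then have "\<alpha> * mean u y \<le> \<alpha> * (mean H y + m)" using \<alpha> by (intro mult_left_mono) auto
      then have "J c u y - JH y \<le> \<alpha> * m" using y by (simp add: J_def JH_def min_def algebra_simps)
      moreover have "u y \<le> J c u y" using u y by (simp add: stopping_value_def)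
      ultimately show ?thesis using H_above_s[of y] False y by auto
    qed
  qed (use \<alpha> assms in auto)
  then show ?thesis by simp
qed

text \<open>Up to \<open>z\<close>, stopping below \<open>s\<close> is the optimal rule:
  \<open>u\<close> is 0 below \<open>s\<close> and equals \<open>J\<close> from there on.\<close>

lemma H_eq_u:
  assumes "x \<in> X" "x \<le> z"
  shows "H x = u x"
proof -
  obtain B B' where B: "\<And>y. y \<in> X \<Longrightarrow> \<bar>u y\<bar> \<le> B" "\<And>y. y \<in> X \<Longrightarrow> \<bar>H y\<bar> \<le> B'"
    using u_bdd H_bdd unfolding bdd_measurable_def by metis
  have "H x - u x \<le> 0"
  proof (rule contraction_nonpos[where f = "\<lambda>x. H x - u x" and A = "X \<inter> {..z}" and B = "B + B'" and \<alpha> = \<alpha>])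
    show "H y - u y \<le> B + B'" if "y \<in> X \<inter> {..z}" for y
      using B[of y] that by auto
    fix m y assume m: "0 \<le> m" and le: "\<And>y. y \<in> X \<inter> {..z} \<Longrightarrow> H y - u y \<le> m" and y: "y \<in> X \<inter> {..z}"
    show "H y - u y \<le> \<alpha> * m"
    proof (cases "y < s")
      case True
      then show ?thesis using y m \<alpha> u_below_s H_below_s by auto
    next
      case False
      have "mean H y \<le> mean u y + m"
        using y le by (intro mean_le_mean u_bdd H_bdd) (force simp: algebra_simps)+
      then have "\<alpha> * mean H y \<le> \<alpha> * (mean u y + m)" using \<alpha> by (intro mult_left_mono) auto
      then have "JH y - J c u y \<le> \<alpha> * m" using y b by (simp add: J_def JH_def min_def algebra_simps)
      then show ?thesis using H_above_s[of y] u_eq_J[of y] False y by auto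
    qed
  qed (use \<alpha> assms in auto)
  then show ?thesis using u_le_H[of x] assms b by auto
qed

lemma H_S: "H S = - K"
  using H_eq_u[OF S z(3)] u_eq_J[OF S s_le_S z(3)] J_S by simp

text \<open>Up to \<open>b\<close> the bound comes from \<open>u\<close>. Beyond \<open>b\<close>
  the payment is \<open>g b - c \<ge> 0\<close>, so any violation of the bound can only come from
  later periods and is discounted.\<close>

lemma H_ge_K:
  assumes "x \<in> X"
  shows "- K \<le> H x"
proof -
  obtain B where B: "\<And>y. y \<in> X \<Longrightarrow> \<bar>H y\<bar> \<le> B"
    using H_bdd unfolding bdd_measurable_def by metis
  have "- K - H x \<le> 0"
  proof (rule contraction_nonpos[where f = "\<lambda>x. - K - H x" and A = X and B = "B - K" and \<alpha> = \<alpha>])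
    show "- K - H y \<le> B - K" if "y \<in> X" for y
      using B[of y] that by auto
    fix m y assume m: "0 \<le> m" and le: "\<And>y. y \<in> X \<Longrightarrow> - K - H y \<le> m" and y: "y \<in> X"
    have am: "0 \<le> \<alpha> * m" using \<alpha> m by simp
    show "- K - H y \<le> \<alpha> * m"
    proof (cases "y \<le> b")
      case True
      then show ?thesis using u_le_H[OF y] u_ge_K[OF y] am by linarith
    next
      case False
      have "- K - m \<le> mean H y"
        using le by (intro mean_ge_const H_bdd y) force
      then have "\<alpha> * (- K - m) \<le> \<alpha> * mean H y" using \<alpha> by (intro mult_left_mono) auto
      moreover have "\<alpha> * K \<le> K" using \<alpha> K_pos by simp
      ultimately have "- K - \<alpha> * m \<le> JH y"
        using False b by (simp add: JH_def min_def algebra_simps)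
      then show ?thesis using H_above_s[OF y] False b z s_le_S by auto
    qed
  qed (use \<alpha> assms in auto)
  then show ?thesis by simp
qed

text \<open>
  Starting two copies at \<open>x\<close> and \<open>y \<ge> x\<close> under the same demands, the upper one pays at least as
  much as the lower one until the lower one enters \<open>{..z}\<close>, where \<open>H \<le> 0\<close>.
\<close>

lemma H_le_H:
  assumes "x \<in> X" "y \<in> X" "x \<le> y"
  shows "H x \<le> K + H y"
proof -
  \<comment> \<open>Common demands preserve the gap, so with \<delta> fixed the claim is a
    contraction in the lower state alone.\<close>
  define \<delta> where "\<delta> = y - x"
  have \<delta>: "0 \<le> \<delta>" "\<delta> \<in> X" using assms X_cases by (auto simp: \<delta>_def)
  have shift: "w + \<delta> \<in> X" if "w \<in> X" for w using that \<delta> X_cases by auto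
  obtain B where B: "\<And>y. y \<in> X \<Longrightarrow> \<bar>H y\<bar> \<le> B"
    using H_bdd unfolding bdd_measurable_def by metis
  have "H x - H (x + \<delta>) - K \<le> 0"
  proof (rule contraction_nonpos[where f = "\<lambda>x. H x - H (x + \<delta>) - K" and A = X and B = "2 * B" and \<alpha> = \<alpha>])
    show "H w - H (w + \<delta>) - K \<le> 2 * B" if "w \<in> X" for w
      using B[of w] B[OF shift[OF that]] that K_pos by auto
    fix m w assume m: "0 \<le> m" and le: "\<And>w. w \<in> X \<Longrightarrow> H w - H (w + \<delta>) - K \<le> m" and w: "w \<in> X"
    have am: "0 \<le> \<alpha> * m" using \<alpha> m by simp
    show "H w - H (w + \<delta>) - K \<le> \<alpha> * m"
    proof (cases "w \<le> z")
      case True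
      have "H w \<le> 0" using H_eq_u[OF w True] stopping_value_nonpos[OF u w] by simp
      then show ?thesis using H_ge_K[OF shift[OF w]] am by linarith
    next
      case False
      have "mean H w \<le> mean H (w + \<delta>) + (K + m)"
      proof (intro mean_le_mean H_bdd w shift)
        fix d assume "w - d \<in> X"
        from le[OF this] show "H (w - d) \<le> H (w + \<delta> - d) + (K + m)"
          by (simp add: algebra_simps)
      qed
      then have "\<alpha> * mean H w \<le> \<alpha> * (mean H (w + \<delta>) + (K + m))"
        using \<alpha> by (intro mult_left_mono) auto
      moreover have "\<alpha> * K \<le> K" using \<alpha> K_pos by simp
      moreover have "g (min w b) \<le> g (min (w + \<delta>) b)"
        using False z b \<delta> by (intro g_increasing min_b_in_X w shift) auto
      ultimately have "JH w - JH (w + \<delta>) - K \<le> \<alpha> * m" by (simp add: JH_def algebra_simps)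
      then show ?thesis
        using H_above_s[OF w] H_above_s[OF shift[OF w]] False z s_le_S \<delta> by auto
    qed
  qed (use \<alpha> assms in auto)
  then show ?thesis by (simp add: \<delta>_def)
qed

lemma JH_below_s:
  assumes "x \<in> X" "x < s"
  shows "0 < JH x"
proof -
  have "0 \<le> mean H x"
    using assms by (intro mean_ge_const H_bdd) (auto simp: H_below_s)
  moreover have "min x b = x" using assms s_le_S z b by auto
  ultimately show ?thesis
    using g_below_s[OF assms] \<alpha> by (simp add: JH_def add_pos_nonneg)
qed

lemma H_le_JH: "x \<in> X \<Longrightarrow> H x \<le> JH x"
  using H_below_s[of x] JH_below_s[of x] H_above_s[of x] by (cases "x < s") auto

text \<open>One half of the optimality equation: not ordering is covered by \<open>H_le_JH\<close>,
  and an order up to \<open>y\<close> by \<open>H_le_H\<close> followed by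
  \<open>H_le_JH\<close>.\<close>

lemma H_optimality_inequality:
  assumes "x \<in> X" "y \<in> X" "x \<le> y"
  shows "H x \<le> (if x < y then K else 0) + JH y"
  using H_le_JH[OF assms(2)] H_le_H[OF assms] assms(3) by auto

text \<open>The half attained by \<phi>: below \<open>s\<close>, ordering up to \<open>S\<close>
  costs \<open>K + JH S = K + H S = 0\<close>, which is the value of \<open>H\<close> there.\<close>

lemma H_optimality_equation:
  assumes "x \<in> X"
  shows "H x = (if \<phi> x > 0 then K else 0) + JH (x + \<phi> x)"
proof (cases "x < s")
  case True
  then show ?thesis using H_below_s[OF assms] H_above_s[OF S s_le_S] H_S s_le_S by (simp add: \<phi>_def)
next
  case False
  then show ?thesis using H_above_s[OF assms] by (simp add: \<phi>_def)
qed

text \<open>Undoes the normalization: \<open>c / (1 - \<alpha>)\<close> returns the level subtracted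
  in every period, and \<open>- cbar * x\<close> returns the unit ordering cost absorbed into
  \<open>g\<close>.\<close>

definition v :: "real \<Rightarrow> real" where
  "v x = c / (1 - \<alpha>) + H x - cbar * x"

lemma integrable_v: "x \<in> X \<Longrightarrow> integrable M (\<lambda>\<omega>. v (x - D 1 \<omega>))"
  using integrable_bdd_measurable[OF H_bdd, of x] D_integrable unfolding v_def by auto

lemma mean_v:
  assumes "x \<in> X"
  shows "mean v x = c / (1 - \<alpha>) + mean H x - cbar * x + cbar * expectation (D 1)"
  using integrable_bdd_measurable[OF H_bdd assms] D_integrable unfolding v_def
  by (simp add: prob_space right_diff_distrib)

text \<open>The constants cancel because \<open>C - c = \<alpha> * C\<close> for
  \<open>C = c / (1 - \<alpha>)\<close>. The last summand is the truncation error, which vanishes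
  for \<open>y \<le> b\<close>.\<close>

lemma mean_v_JH:
  assumes "y \<in> X"
  shows "mean h y + \<alpha> * mean v y = c / (1 - \<alpha>) - cbar * y + (JH y + (g y - g (min y b)))"
proof -
  define C where "C = c / (1 - \<alpha>)"
  have "C - c = \<alpha> * C" using \<alpha> by (simp add: C_def field_simps)
  then show ?thesis
    unfolding mean_v[OF assms] mean_h[OF assms] JH_def C_def[symmetric] by (simp add: algebra_simps)
qed

lemma cost_mean_v:
  assumes "x \<in> X" "a \<in> X"
  shows "cost x a + \<alpha> * mean v (x + a) = c / (1 - \<alpha>) - cbar * x +
    ((if a > 0 then K else 0) + JH (x + a)) + (g (x + a) - g (min (x + a) b))"
proof -
  have "x + a \<in> X" using assms X_cases by auto
  from mean_v_JH[OF this] show ?thesis by (simp add: cost_def algebra_simps)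
qed

text \<open>Beyond \<open>b\<close> the truncation error is nonnegative by monotonicity of
  \<open>g\<close>, so the inequality survives for orders of any size.\<close>

lemma v_le:
  assumes "x \<in> X" "a \<in> X" "0 \<le> a"
  shows "v x \<le> cost x a + \<alpha> * mean v (x + a)"
proof -
  have y: "x + a \<in> X" using assms X_cases by auto
  have "g (min (x + a) b) \<le> g (x + a)"
    using g_increasing[OF b(1) y] b z by (auto simp: min_def)
  then show ?thesis
    unfolding cost_mean_v[OF assms(1,2)] v_def[of x]
    using H_optimality_inequality[OF assms(1) y] assms(3) by auto
qed

lemma order_le_b: "x \<le> b \<Longrightarrow> x + \<phi> x \<le> b"
  using b z by (auto simp: \<phi>_def)

lemma order_in_X: "x \<in> X \<Longrightarrow> x + \<phi> x \<in> X"
  using S by (auto simp: \<phi>_def)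

lemma v_eq:
  assumes "x \<in> X" "x \<le> b"
  shows "v x = cost x (\<phi> x) + \<alpha> * mean v (x + \<phi> x)"
  using cost_mean_v[OF assms(1), of "\<phi> x"] \<phi>_action[OF assms(1)] H_optimality_equation[OF assms(1)]
    order_le_b[OF assms(2)]
  by (simp add: v_def[of x])

text \<open>Since \<open>H\<close> is bounded, \<open>v\<close> becomes negative far to the right,
  so the claim is confined to states up to \<open>b\<close>. The (s, S) policy stays there, and by
  \<open>v_eq\<close> a lower bound \<open>- m\<close> improves to \<open>- (\<alpha> * m)\<close>
  as costs are nonnegative.\<close>

lemma v_nonneg:
  assumes "x \<in> X" "x \<le> b"
  shows "0 \<le> v x"
proof -
  obtain B where B: "\<And>y. y \<in> X \<Longrightarrow> \<bar>H y\<bar> \<le> B"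
    using H_bdd unfolding bdd_measurable_def by metis
  have "- v x \<le> 0"
  proof (rule contraction_nonpos[where f = "\<lambda>x. - v x" and A = "X \<inter> {..b}" and \<alpha> = \<alpha>
        and B = "B - c / (1 - \<alpha>) + cbar * b"])
    show "- v y \<le> B - c / (1 - \<alpha>) + cbar * b" if "y \<in> X \<inter> {..b}" for y
    proof -
      have "cbar * y \<le> cbar * b" using that cbar_pos by simp
      then show ?thesis using B[of y] that unfolding v_def by (auto simp: abs_le_iff)
    qed
    fix m y assume m: "0 \<le> m" and le: "\<And>y. y \<in> X \<inter> {..b} \<Longrightarrow> - v y \<le> m" and y: "y \<in> X \<inter> {..b}"
    have "- m \<le> mean v (y + \<phi> y)"
    proof (rule integral_ge_const[OF integrable_v])
      show yX: "y + \<phi> y \<in> X" using y order_in_X by auto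
      show "AE \<omega> in M. - m \<le> v (y + \<phi> y - D 1 \<omega>)"
      proof (rule AE_I2)
        fix \<omega> assume "\<omega> \<in> space M"
        then have "y + \<phi> y - D 1 \<omega> \<in> X \<inter> {..b}"
          using minus_demand_in_X[OF yX, of 1] D_nonneg[of 1 \<omega>] order_le_b[of y] y by auto
        from le[OF this] show "- m \<le> v (y + \<phi> y - D 1 \<omega>)" by simp
      qed
    qed
    then have "\<alpha> * (- m) \<le> \<alpha> * mean v (y + \<phi> y)" using \<alpha> by (intro mult_left_mono) auto
    moreover have "0 \<le> cost y (\<phi> y)" using y \<phi>_action by (intro cost_nonneg) auto
    ultimately show "- v y \<le> \<alpha> * m" using v_eq[of y] y by auto
  qed (use \<alpha> assms in auto)
  then show ?thesis by simp
qed

lemma measurable_v: "v \<in> borel_measurable state_space"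
proof -
  have [measurable]: "H \<in> borel_measurable state_space" using H_bdd by (simp add: bdd_measurable_def)
  have [measurable]: "(\<lambda>y. y) \<in> borel_measurable state_space" by (simp add: state_space_borel)
  show ?thesis unfolding v_def by measurable
qed

text \<open>Passing to \<open>ennreal\<close> replaces \<open>v\<close> by its positive part, which
  can only raise the average.\<close>

lemma mean_v_le_after_demand:
  assumes "y \<in> X"
  shows "ennreal (mean v y) \<le> after_demand (\<lambda>y. ennreal (v y)) y"
proof -
  have int: "integrable M (\<lambda>\<omega>. max 0 (v (y - D 1 \<omega>)))"
    using integrable_v[OF assms] by auto
  have "ennreal (mean v y) \<le> ennreal (expectation (\<lambda>\<omega>. max 0 (v (y - D 1 \<omega>))))"
    by (intro ennreal_leI integral_mono integrable_v assms int) auto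
  also have "\<dots> = (\<integral>\<^sup>+\<omega>. ennreal (max 0 (v (y - D 1 \<omega>))) \<partial>M)"
    by (rule nn_integral_eq_integral[symmetric, OF int]) auto
  finally show ?thesis by (simp add: after_demand_def)
qed

text \<open>Demand cannot lift the state above \<open>b\<close>, so only the values of
  \<open>F\<close> up to \<open>b\<close> count. A general \<open>F\<close> serves both the bound
  cut off at \<open>b\<close> and the value function itself.\<close>

lemma after_demand_below_b:
  assumes "y \<in> X" "y \<le> b" and F: "\<And>w. w \<in> X \<Longrightarrow> w \<le> b \<Longrightarrow> F w = ennreal (v w)"
  shows "after_demand F y = ennreal (mean v y)" "0 \<le> mean v y"
proof -
  have yb: "y - D 1 \<omega> \<in> X \<and> y - D 1 \<omega> \<le> b" if "\<omega> \<in> space M" for \<omega>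
    using minus_demand_in_X[OF assms(1), of 1 \<omega>] D_nonneg[of 1 \<omega>] assms(2) that by auto
  have "after_demand F y = (\<integral>\<^sup>+\<omega>. ennreal (v (y - D 1 \<omega>)) \<partial>M)"
    unfolding after_demand_def using yb F by (intro nn_integral_cong) auto
  also have "\<dots> = ennreal (mean v y)"
    using yb v_nonneg by (intro nn_integral_eq_integral integrable_v assms) auto
  finally show "after_demand F y = ennreal (mean v y)" .
  show "0 \<le> mean v y"
    using yb v_nonneg by (intro integral_nonneg_AE) auto
qed

section \<open>Verification: \<open>v\<close> is the value function up to \<open>b\<close>\<close>

lemma v_le_policy_value:
  assumes pi: "\<pi> \<in> policies" and x: "x \<in> X"
  shows "ennreal (v x) \<le> policy_value \<alpha> \<pi> x"
proof -
  obtain B where B: "\<And>y. y \<in> X \<Longrightarrow> \<bar>H y\<bar> \<le> B"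
    using H_bdd unfolding bdd_measurable_def by metis
  define B' where "B' = \<bar>c / (1 - \<alpha>) + B\<bar>"
  show ?thesis
  proof (rule le_policy_value[OF \<alpha> pi x, where B = B' and k = cbar])
    show "(\<lambda>y. ennreal (v y)) \<in> borel_measurable state_space"
      using measurable_v by measurable
    show "ennreal (v y) \<le> ennreal (cost y a) + ennreal \<alpha> * after_demand (\<lambda>y. ennreal (v y)) (y + a)"
      if "y \<in> X" "a \<in> X" "0 \<le> a" for y a
    proof -
      have ya: "y + a \<in> X" using that X_cases by auto
      have "ennreal (v y) \<le> ennreal (cost y a + \<alpha> * mean v (y + a))"
        by (rule ennreal_leI[OF v_le[OF that]])
      \<comment> \<open>\<open>mean v (y + a)\<close> may be negative when \<open>y + a\<close>
        exceeds \<open>b\<close>, so it is cut at 0 before the sum is split in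
        \<open>ennreal\<close>.\<close>
      also have "\<dots> \<le> ennreal (cost y a + \<alpha> * max 0 (mean v (y + a)))"
        using \<alpha> by (intro ennreal_leI add_left_mono mult_left_mono) auto
      also have "\<dots> = ennreal (cost y a) + ennreal \<alpha> * ennreal (mean v (y + a))"
        using cost_nonneg[OF that] \<alpha> by (subst ennreal_plus) (auto simp: ennreal_mult)
      also have "\<dots> \<le> ennreal (cost y a) + ennreal \<alpha> * after_demand (\<lambda>y. ennreal (v y)) (y + a)"
        by (intro add_left_mono mult_left_mono mean_v_le_after_demand ya) simp
      finally show ?thesis .
    qed
    show "ennreal (v y) \<le> ennreal (B' + cbar * max 0 (- y))" if "y \<in> X" for y
    proof (rule ennreal_leI)
      have "cbar * (- y) \<le> cbar * max 0 (- y)" using cbar_pos by (intro mult_left_mono) auto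
      moreover have "c / (1 - \<alpha>) + H y \<le> B'" using B[OF that] unfolding B'_def by linarith
      ultimately show "v y \<le> B' + cbar * max 0 (- y)" unfolding v_def by linarith
    qed
  qed (use cbar_pos in \<open>auto simp: B'_def\<close>)
qed

lemma policy_value_le_v:
  assumes x: "x \<in> X" "x \<le> b"
  shows "policy_value \<alpha> (stationary_policy \<phi>) x \<le> ennreal (v x)"
proof -
  \<comment> \<open>The value \<top> above \<open>b\<close> makes the supersolution inequality
    trivial there and does no harm below, because the (s, S) policy never crosses \<open>b\<close>
    from below.\<close>
  define F where "F y = (if y \<le> b then ennreal (v y) else \<top>)" for y
  have "policy_value \<alpha> (stationary_policy \<phi>) x \<le> F x"
  proof (rule policy_value_stationary_le[OF \<alpha>(1) stationary_\<phi> x(1) measurable_\<phi>])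
    note [measurable] = measurable_v
    have [measurable]: "(\<lambda>y. y) \<in> borel_measurable state_space" by (simp add: state_space_borel)
    show "F \<in> borel_measurable state_space" unfolding F_def by measurable
    fix y assume y: "y \<in> X"
    show "ennreal (cost y (\<phi> y)) + ennreal \<alpha> * after_demand F (y + \<phi> y) \<le> F y"
    proof (cases "y \<le> b")
      case True
      note ad = after_demand_below_b[OF order_in_X[OF y] order_le_b[OF True], of F]
      have "cost y (\<phi> y) \<ge> 0" using \<phi>_action[OF y] y by (intro cost_nonneg) auto
      then have "ennreal (cost y (\<phi> y)) + ennreal \<alpha> * after_demand F (y + \<phi> y) =
          ennreal (cost y (\<phi> y) + \<alpha> * mean v (y + \<phi> y))"
        using ad \<alpha> by (subst ennreal_plus) (auto simp: ennreal_mult F_def)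
      then show ?thesis using v_eq[OF y True] True by (simp add: F_def)
    qed (simp add: F_def)
  qed
  then show ?thesis using x by (simp add: F_def)
qed

lemma value_fun_eq:
  assumes "x \<in> X" "x \<le> b"
  shows "value_fun \<alpha> x = ennreal (v x)" "policy_value \<alpha> (sS_policy s S) x = value_fun \<alpha> x"
proof -
  have 1: "value_fun \<alpha> x \<le> policy_value \<alpha> (sS_policy s S) x"
    unfolding value_fun_def sS_policy_eq by (rule INF_lower[OF stationary_\<phi>])
  have 2: "policy_value \<alpha> (sS_policy s S) x \<le> ennreal (v x)"
    unfolding sS_policy_eq by (rule policy_value_le_v[OF assms])
  have 3: "ennreal (v x) \<le> value_fun \<alpha> x"
    unfolding value_fun_def by (rule INF_greatest) (rule v_le_policy_value[OF _ assms(1)])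
  show "value_fun \<alpha> x = ennreal (v x)" "policy_value \<alpha> (sS_policy s S) x = value_fun \<alpha> x"
    using 1 2 3 by auto
qed

lemma G_eq:
  assumes "x \<in> X" "x \<le> b"
  shows "G \<alpha> x = ereal (c / (1 - \<alpha>) + JH x)"
proof -
  note ad = after_demand_below_b[OF assms, of "value_fun \<alpha>", OF value_fun_eq(1)]
  have "G \<alpha> x = ereal (cbar * x + mean h x) + ereal \<alpha> * enn2ereal (after_demand (value_fun \<alpha>) x)"
    by (simp add: G_def after_demand_def)
  also have "\<dots> = ereal (cbar * x + (mean h x + \<alpha> * mean v x))"
    using ad by simp
  also have "\<dots> = ereal (c / (1 - \<alpha>) + JH x)"
    unfolding mean_v_JH[OF assms(1)] using assms(2) by simp
  finally show ?thesis .
qed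

end

lemma (in quasiconvex_inventory) critical_inventory_exists:
  "\<exists>c u S. critical_inventory M X D h K cbar \<alpha> g y0 N c u S"
proof (rule critical_level)
  fix c u S
  assume "g y0 \<le> c" "c \<le> g y0 + K" "stopping_value c u" "S \<in> X" "J c u S = - K"
    "\<And>x. x \<in> X \<Longrightarrow> - K \<le> J c u x"
  then have "critical_inventory M X D h K cbar \<alpha> g y0 N c u S"
    by unfold_locales
  then show ?thesis by blast
qed

section \<open>Removing the truncation: optimality at all states and the shape of
  \<open>G \<alpha>\<close>\<close>

context critical_inventory
begin

text \<open>Every state lies below an admissible truncation level, so results for states up to
  \<open>b\<close> extend to all of \<open>X\<close>.\<close>

lemma truncation_exists:
  assumes "x \<in> X"
  obtains b H where "x \<le> b" "truncated_inventory M X D h K cbar \<alpha> g y0 N c u S b H"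
proof -
  obtain b0 where b0: "b0 \<in> X" "\<And>y. y \<in> X \<Longrightarrow> b0 \<le> y \<Longrightarrow> c \<le> g y" using g_right by metis
  define b where "b = max b0 (max x z)"
  have b: "b \<in> X" "z \<le> b" "c \<le> g b" "x \<le> b"
    using b0 z(1) assms by (auto simp: b_def max_def)
  have ms: "(\<lambda>x. min x b) \<in> state_space \<rightarrow>\<^sub>M state_space"
    unfolding state_space_def using b(1)
    by (intro measurable_restrict_space2 measurable_restrict_space1) (auto simp: space_restrict_space min_def)
  note [measurable] = measurable_compose[OF ms g_measurable]
  have [measurable]: "(\<lambda>y. y) \<in> borel_measurable state_space" by (simp add: state_space_borel)
  obtain H where "bdd_measurable H"
    "\<And>x. x \<in> X \<Longrightarrow> H x = (if x < s then 0 else g (min x b) - c + \<alpha> * mean H x)"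
  \<comment> \<open>From \<open>s\<close> on, \<open>g (min x b)\<close> lies between
    \<open>g y0\<close> and \<open>max c (g b)\<close>: it decreases from \<open>g s \<le> c\<close>
    up to \<open>y0\<close> and then increases to at most \<open>g b\<close>.\<close>
  proof (rule discounted_fixpoint[where \<alpha> = \<alpha> and B = "\<bar>g b - c\<bar> + (c - g y0)"
        and \<Phi> = "\<lambda>x e. if x < s then 0 else g (min x b) - c + e"])
    fix x assume x: "x \<in> X"
    show "\<bar>if x < s then 0 else g (min x b) - c + 0\<bar> \<le> \<bar>g b - c\<bar> + (c - g y0)"
    proof (cases "x < s")
      case False
      have mX: "min x b \<in> X" using x b by (auto simp: min_def)
      have "g (min x b) \<le> max c (g b)"
      proof (cases "min x b \<le> y0")
        case True
        have "s \<le> min x b" using False s_le_S z b by auto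
        from g_decreasing[OF s_facts(1) mX this True] show ?thesis using s_facts(2) by simp
      next
        case False
        then have "g (min x b) \<le> g b" by (intro g_increasing mX b) auto
        then show ?thesis by simp
      qed
      then show ?thesis using g_min[OF mX] b c False by auto
    qed (use c in auto)
  next
    show "(\<lambda>x. if x < s then 0 else g (min x b) - c + f x) \<in> borel_measurable state_space"
      if [measurable]: "f \<in> borel_measurable state_space" for f
      by measurable
  qed (use \<alpha> in auto)
  then have "truncated_inventory M X D h K cbar \<alpha> g y0 N c u S b H"
    using b by unfold_locales auto
  then show thesis using that b by blast
qed

text \<open>The level \<open>b\<close> and the function \<open>H\<close> vary with the initial
  state, but \<open>s\<close> and \<open>S\<close> do not, so a single policy is optimal
  everywhere.\<close>

lemma optimal_sS_policy: "optimal \<alpha> (sS_policy s S)"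
  unfolding optimal_def
proof (intro conjI ballI)
  show "sS_policy s S \<in> policies" by (rule sS_policy_in_policies[OF s_le_S S])
  fix x assume x: "x \<in> X"
  obtain b H where "x \<le> b" and "truncated_inventory M X D h K cbar \<alpha> g y0 N c u S b H"
    using truncation_exists[OF x] .
  then interpret truncated_inventory M X D h K cbar \<alpha> g y0 N c u S b H by simp
  show "policy_value \<alpha> (sS_policy s S) x = value_fun \<alpha> x"
    by (rule value_fun_eq(2)[OF x \<open>x \<le> b\<close>])
qed

lemma G_facts:
  assumes x: "x \<in> X"
  shows "G \<alpha> S = ereal (c / (1 - \<alpha>) - K)" "G \<alpha> S \<le> G \<alpha> x"
    "x \<le> S \<Longrightarrow> G \<alpha> x \<le> ereal (c / (1 - \<alpha>)) \<longleftrightarrow> s \<le> x"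
proof -
  obtain b H where xb: "x \<le> b" and "truncated_inventory M X D h K cbar \<alpha> g y0 N c u S b H"
    using truncation_exists[OF x] .
  then interpret truncated_inventory M X D h K cbar \<alpha> g y0 N c u S b H by simp
  have "S \<le> b" using b z by linarith
  then show GS: "G \<alpha> S = ereal (c / (1 - \<alpha>) - K)"
    using H_S H_above_s[OF S s_le_S] by (simp add: G_eq[OF S])
  show "G \<alpha> S \<le> G \<alpha> x"
    unfolding GS G_eq[OF x xb] using H_le_JH[OF x] H_ge_K[OF x] by simp
  show "G \<alpha> x \<le> ereal (c / (1 - \<alpha>)) \<longleftrightarrow> s \<le> x" if "x \<le> S"
  proof (cases "s \<le> x")
    case True
    have "x \<le> z" using that z by linarith
    then have "JH x \<le> 0"
      using H_above_s[OF x True] H_eq_u[OF x] stopping_value_nonpos[OF u x] by simp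
    then show ?thesis using True G_eq[OF x xb] by simp
  next
    case False
    then show ?thesis using JH_below_s[OF x] G_eq[OF x xb] by simp
  qed
qed

text \<open>As \<open>K + G \<alpha> S = c / (1 - \<alpha>)\<close>, the condition says that
  \<open>JH x \<le> 0\<close>, which for \<open>x \<le> S\<close> holds exactly from
  \<open>s\<close> on.\<close>

lemma reorder_set:
  "{x \<in> X. x \<le> S \<and> G \<alpha> x \<le> ereal K + G \<alpha> S} = {x \<in> X. s \<le> x \<and> x \<le> S}"
  using G_facts by auto

lemma sS_conclusion:
  "\<exists>s S :: real. s \<le> S \<and> is_arg_min (G \<alpha>) (\<lambda>x. x \<in> X) S \<and>
    ereal s = (INF x\<in>{x \<in> X. x \<le> S \<and> G \<alpha> x \<le> ereal K + G \<alpha> S}. ereal x) \<and>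
    optimal \<alpha> (sS_policy s S)"
proof (intro exI conjI)
  show "is_arg_min (G \<alpha>) (\<lambda>x. x \<in> X) S"
    using S G_facts(2) by (auto simp: is_arg_min_def not_less)
  show "ereal s = (INF x\<in>{x \<in> X. x \<le> S \<and> G \<alpha> x \<le> ereal K + G \<alpha> S}. ereal x)"
    unfolding reorder_set using s_facts(1) s_le_S
    by (intro antisym INF_greatest INF_lower) auto
qed (rule s_le_S optimal_sS_policy)+

end

section \<open>From the hypotheses of the theorem to the normalized model\<close>

context inventory_model
begin

lemma Eh_disc_eq:
  assumes "y \<in> X"
  shows "Eh_disc \<alpha> y = mean h y + (1 - \<alpha>) * cbar * y + \<alpha> * cbar * expectation (D 1)"
proof -
  have "Eh_disc \<alpha> y = mean h y + ((1 - \<alpha>) * cbar * (y - expectation (D 1)) + cbar * expectation (D 1))"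
    unfolding Eh_disc_def h_disc_def
    using h_integrable[OF assms] D_integrable by (simp add: prob_space add.assoc)
  then show ?thesis by (simp add: algebra_simps)
qed

lemma quasiconvex_inventory_Eh_disc:
  fixes L :: ereal
  assumes \<alpha>: "0 < \<alpha>" "\<alpha> < 1"
    and qc: "quasiconvex_on X (Eh_disc \<alpha>)"
    and L: "((\<lambda>x. ereal (Eh_disc \<alpha> x)) \<longlongrightarrow> L) (inf at_bot (principal X))"
    and L_gt: "L > ereal K + (INF x\<in>X. ereal (Eh_disc \<alpha> x))"
  obtains y0 N where "quasiconvex_inventory M X D h K cbar \<alpha> (Eh_disc \<alpha>) y0 N"
proof -
  let ?g = "Eh_disc \<alpha>"
  have cont: "continuous_on X ?g"
    using h_cont by (subst continuous_on_cong[OF refl Eh_disc_eq]) (auto intro!: continuous_intros)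
  have right: "\<exists>b\<in>X. \<forall>y\<in>X. b \<le> y \<longrightarrow> B \<le> ?g y" for B
  proof -
    define B' where "B' = B - \<alpha> * cbar * expectation (D 1)"
    have "eventually (\<lambda>y. B' \<le> mean h y) (inf at_infinity (principal X))"
      using h_lim by (auto simp: filterlim_at_top)
    then obtain b where b: "\<And>y. y \<in> X \<Longrightarrow> b \<le> \<bar>y\<bar> \<Longrightarrow> B' \<le> mean h y"
      by (auto simp: eventually_inf_principal eventually_at_infinity)
    \<comment> \<open>Rounding up places the bound in \<open>X\<close> in the integer model too;
      being nonnegative, it also gives the linear term of \<open>Eh_disc\<close> the right
      sign.\<close>
    define b' where "b' = real_of_int \<lceil>max b 0\<rceil>"
    have "b' \<in> X" using X_cases by (auto simp: b'_def)
    moreover have "B \<le> ?g y" if y: "y \<in> X" "b' \<le> y" for y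
    proof -
      have "max b 0 \<le> y"
        using le_of_int_ceiling[of "max b 0"] y(2) unfolding b'_def by linarith
      moreover from this have "0 \<le> (1 - \<alpha>) * cbar * y" using \<alpha> cbar_pos by simp
      ultimately show ?thesis using b[OF y(1)] by (simp add: Eh_disc_eq[OF y(1)] B'_def)
    qed
    ultimately show ?thesis by blast
  qed
  \<comment> \<open>A real level strictly between the two sides of (ii), available also when
    \<open>L\<close> is infinite. It supplies \<open>N\<close>, and it confines the sublevel set of
    \<open>x0\<close>: at -\<infinity> the linear term works against coercivity, so (ii) takes its
    place.\<close>
  obtain l where l: "ereal K + (INF x\<in>X. ereal (?g x)) < ereal l" "ereal l < L"
    using ereal_dense2[OF L_gt] by auto
  have "(INF x\<in>X. ereal (?g x)) < ereal (l - K)"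
    using l(1) by (cases "INF x\<in>X. ereal (?g x)") auto
  then obtain x0 where x0: "x0 \<in> X" "?g x0 < l - K"
    by (auto simp: INF_less_iff)
  have "eventually (\<lambda>x. ereal l < ereal (?g x)) (inf at_bot (principal X))"
    by (rule order_tendstoD(1)[OF L l(2)])
  then obtain N where N: "\<And>x. x \<in> X \<Longrightarrow> x \<le> N \<Longrightarrow> l < ?g x"
    by (auto simp: eventually_inf_principal eventually_at_bot_linorder)
  obtain b where b: "\<And>y. y \<in> X \<Longrightarrow> b \<le> y \<Longrightarrow> l \<le> ?g y" using right by metis
  have "\<exists>z\<in>X. \<forall>x\<in>X. ?g z \<le> ?g x"
  proof (rule attains_min[OF cont x0(1)])
    fix x assume "x \<in> X" "?g x \<le> ?g x0"
    then show "N \<le> x \<and> x \<le> b" using N[of x] b[of x] x0 K_pos by force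
  qed
  then obtain y0 where y0: "y0 \<in> X" "\<And>x. x \<in> X \<Longrightarrow> ?g y0 \<le> ?g x" by blast
  have between: "?g y \<le> max (?g x) (?g w)"
    if "x \<in> X" "y \<in> X" "w \<in> X" "x \<le> y" "y \<le> w" for x y w
  proof (cases "x = w")
    case False
    \<comment> \<open>The weight that writes \<open>y\<close> as a convex combination of
      \<open>x\<close> and \<open>w\<close>.\<close>
    define t where "t = (w - y) / (w - x)"
    have t: "t \<in> {0..1}" using that False by (auto simp: t_def field_simps)
    have "t * (w - x) = w - y" using False by (simp add: t_def)
    then have y: "y = t * x + (1 - t) * w" by (simp add: algebra_simps)
    show ?thesis using qc that t unfolding quasiconvex_on_def y by blast
  qed (use that in auto)
  have "quasiconvex_inventory M X D h K cbar \<alpha> ?g y0 N"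
  proof unfold_locales
    show "?g y \<le> ?g x" if "x \<in> X" "y \<in> X" "x \<le> y" "y \<le> y0" for x y
      using between[OF that(1,2) y0(1) that(3,4)] y0(2)[OF that(1)] by simp
    show "?g x \<le> ?g y" if "x \<in> X" "y \<in> X" "y0 \<le> x" "x \<le> y" for x y
      using between[OF y0(1) that] y0(2)[OF that(2)] by simp
    show "?g y0 + K < ?g y" if "y \<in> X" "y < N" for y
      using N[of y] that y0(2)[OF x0(1)] x0(2) by simp
  qed (use \<alpha> cont y0 right Eh_disc_eq in auto)
  then show thesis by (rule that)
qed

end

theorem theorem3p4:
  fixes M :: "'w measure" and X :: "real set" and D :: "nat \<Rightarrow> 'w \<Rightarrow> real"
    and h :: "real \<Rightarrow> real" and K cbar \<alpha> :: real and L :: ereal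
  assumes "inventory_model M X D h K cbar"
    and "0 < \<alpha>" and "\<alpha> < 1"
    and "quasiconvex_on X (inventory_model.Eh_disc M D h cbar \<alpha>)"
    and "((\<lambda>x. ereal (inventory_model.Eh_disc M D h cbar \<alpha> x)) \<longlongrightarrow> L) (inf at_bot (principal X))"
    and "L > ereal K + (INF x\<in>X. ereal (inventory_model.Eh_disc M D h cbar \<alpha> x))"
  shows "\<exists>s S :: real. s \<le> S \<and>
      is_arg_min (inventory_model.G M X D h K cbar \<alpha>) (\<lambda>x. x \<in> X) S \<and>
      ereal s = (INF x\<in>{x \<in> X. x \<le> S \<and>
                    inventory_model.G M X D h K cbar \<alpha> x
                      \<le> ereal K + inventory_model.G M X D h K cbar \<alpha> S}. ereal x) \<and>
      inventory_model.optimal M X D h K cbar \<alpha> (inventory_model.sS_policy X s S)"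
proof -
  interpret inventory_model M X D h K cbar by (rule assms(1))
  obtain y0 N where "quasiconvex_inventory M X D h K cbar \<alpha> (Eh_disc \<alpha>) y0 N"
    using quasiconvex_inventory_Eh_disc[OF assms(2-6)] .
  then interpret quasiconvex_inventory M X D h K cbar \<alpha> "Eh_disc \<alpha>" y0 N .
  obtain c u S where "critical_inventory M X D h K cbar \<alpha> (Eh_disc \<alpha>) y0 N c u S"
    using critical_inventory_exists by blast
  then interpret critical_inventory M X D h K cbar \<alpha> "Eh_disc \<alpha>" y0 N c u S .
  show ?thesis by (rule sS_conclusion)
qed

end
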